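(* Let $p\ge1$ be an integer and $0\le j\le p$. For $\vec s\in\mathbb{R}^{2p+1}$ with $s=|\vec s|$ and $R>s\ge0$, \[\int_{\vec x\in S^{2p}_R}\psi_j(|\vec x-\vec s|)\,\mathrm{d}\vec x=(-2\pi)^p\,2\,e^{-R}\sum_{i=0}^{p-j}\binom{p-j}{i}\chi_{i+p}(R)\tau_{i+j}(s).\]
   Context: $S^{2p}_R\subset\mathbb{R}^{2p+1}$ is the sphere of radius $R$ centred at the origin with its surface measure. For $r>0$, $\psi_0(r)=e^{-r}$ and $\psi_{i+1}(r)=-\frac1r\psi_i'(r)$. The functions $\tau_i$ are defined by $\tau_0=\cosh$ and $\tau_{i+1}(s)=-\frac1s\tau_i'(s)$ for $s\ne0$, extended continuously (as even real-analytic functions) to $s=0$. The reverse Bessel polynomials are $\chi_0(R)=1$, $\chi_1(R)=R$, $\chi_{i+2}(R)=R^2\chi_i(R)+(2i+1)\chi_{i+1}(R)$. *)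

theory Defs
  imports "HOL-Analysis.Analysis"
begin

fun psi :: "nat \<Rightarrow> real \<Rightarrow> real" where
  "psi 0 r = exp (- r)"
| "psi (Suc i) r = - deriv (psi i) r / r"

fun tau :: "nat \<Rightarrow> real \<Rightarrow> real" where
  "tau 0 s = cosh s"
| "tau (Suc i) s =
     (if s \<noteq> 0 then - deriv (tau i) s / s
      else Lim (at 0) (\<lambda>t. - deriv (tau i) t / t))"

text \<open>Reverse Bessel polynomials.\<close>
fun chi :: "nat \<Rightarrow> real \<Rightarrow> real" where
  "chi 0 R = 1"
| "chi (Suc 0) R = R"
| "chi (Suc (Suc i)) R = R\<^sup>2 * chi i R + (2 * real i + 1) * chi (Suc i) R"

text \<open>Surface measure on the sphere of radius R in real^'n, defined via the
  cone construction: sigma_R(A) = (n/R) * lambda({t x. 0 \<le> t \<le> 1, x \<in> A}),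
  which coincides with the (n-1)-dimensional surface (Hausdorff) measure.\<close>
definition cone_over :: "(real^'n) set \<Rightarrow> (real^'n) set" where
  "cone_over A = {t *\<^sub>R x | t x. t \<in> {0..1} \<and> x \<in> A}"

definition sphere_measure :: "real \<Rightarrow> (real^'n::finite) measure" where
  "sphere_measure R =
     measure_of (sphere 0 R) (sets (restrict_space lborel (sphere 0 R)))
       (\<lambda>A. ennreal (real CARD('n) / R) * emeasure lborel (cone_over A))"

end

theory Submission
  imports Defs
begin

text \<open>
  By rotation invariance, the push-forward of the surface measure of the sphere in dimension
  2p + 1 under x \<mapsto> (x \<bullet> e) / R has a density proportional to (1 - w^2)^(p - 1) on [-1, 1], so the
  left-hand side is a multiple of the integral Z(p, j, s) of \<psi>_j(r(w)) (1 - w^2)^(p - 1) dw with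
  r(w)^2 = R^2 + s^2 - 2Rsw. Integrating by parts, the relation r^2 \<psi>_(j+2) = \<psi>_j + (2j + 1) \<psi>_(j+1)
  expresses Z(p, j) through Z(p, j+1), Z(p, j+2) and Z(p+1, j+3), while differentiation in s
  expresses Z(p+1, j+2) through Z(p, j+1) and the derivative of Z(p, j). The right-hand sides
  satisfy the same two relations, by the three-term recurrences of \<chi> and \<tau> and Pascal's rule.
  Induction on p settles j = p and j = p - 1 (three elementary integrals start it), and the first
  relation then lowers j. The case s = 0 follows by continuity.
\<close>

section \<open>The surface measure and its projection to an axis\<close>

text \<open>The induction is governed by the gap p - j. Lowering at (p, j) calls on (p, j+1), (p,
  j+2) and (p+1, j+3), all of smaller gap, but it needs a gap of at least 2, since otherwise some
  index leaves its range. Gaps 0 and 1 must therefore come from the differentiated relation, which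
  reaches (p+1, j+2) from (p, j) and (p, j+1) and so lowers the gap by one while raising p. Gap 1 at
  p + 1 thus asks for gap 2 at p, which lowering provides from gaps 0 and 1 at p together with gap 0
  at p + 1. From p = 1 this detour would start at j = -1; hence a third elementary integral, at p =
  2 and j = 1, beside the two at p = 1. The odd dimension 2p + 1 is what makes the exponent p - 1 of
  the density an integer.\<close>

text \<open>
  The library has this only for index types of class wellorder. With B the unit ball, Fubini and
  the substitution x \<mapsto> c - x for y = T c exchange A and B in the double integral of
  1_A(T x) 1_B(y - T x), and T preserves B.
\<close>
lemma emeasure_lborel_orthogonal_vimage:
  fixes T :: "'a::euclidean_space \<Rightarrow> 'a"
  assumes T: "orthogonal_transformation T" and A: "A \<in> sets borel"
  shows "emeasure lborel (T -` A) = emeasure lborel A"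
proof -
  define B :: "'a set" where "B = ball 0 1"
  have B: "B \<in> sets borel" by (simp add: B_def)
  have lin: "linear T" using T by (rule orthogonal_transformation_linear)
  have cont: "continuous_on UNIV T" using lin by (rule linear_continuous_on_compose[OF continuous_on_id, simplified])
  have [measurable]: "T \<in> borel_measurable borel"
    using cont by (rule borel_measurable_continuous_onI)
  note [measurable] = A B
  have vB: "T -` B = B"
    using T by (auto simp: B_def orthogonal_transformation_norm)
  have shift: "(\<integral>\<^sup>+ y. indicator C (y - a) \<partial>lborel) = emeasure lborel C" if C: "C \<in> sets borel" for C and a :: 'a
  proof -
    have "(\<integral>\<^sup>+ y. indicator C (y - a) \<partial>lborel) = (\<integral>\<^sup>+ y. indicator C y \<partial>distr lborel borel (\<lambda>y. -a + y))"
      using C by (subst nn_integral_distr) auto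
    also have "distr lborel borel (\<lambda>y. -a + y) = lborel"
      by (rule lborel_distr_plus)
    finally show ?thesis using C by simp
  qed
  have reflect: "(\<integral>\<^sup>+ x. f (c - x) \<partial>lborel) = (\<integral>\<^sup>+ x. f x \<partial>lborel)" if f: "f \<in> borel_measurable borel" for f and c :: 'a
  proof -
    have "lborel = density (distr lborel borel (\<lambda>x::'a. c + (-1) *\<^sub>R x)) (\<lambda>_. ennreal (\<bar>-1\<bar>^DIM('a)))"
      by (rule lborel_affine) simp
    hence "lborel = distr lborel borel (\<lambda>x. c - x)" by (simp add: density_1)
    hence "(\<integral>\<^sup>+ x. f x \<partial>lborel) = (\<integral>\<^sup>+ x. f x \<partial>distr lborel borel (\<lambda>x. c - x))" by simp
    also have "\<dots> = (\<integral>\<^sup>+ x. f (c - x) \<partial>lborel)" using f by (subst nn_integral_distr) auto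
    finally show ?thesis ..
  qed
  have pre: "(\<integral>\<^sup>+ x. indicator C (T x) \<partial>lborel) = emeasure lborel (T -` C)"
    if [measurable]: "C \<in> sets borel" for C
  proof -
    have "T -` C \<in> sets borel"
      using measurable_sets[OF \<open>T \<in> borel_measurable borel\<close> that] by simp
    thus ?thesis by (simp flip: nn_integral_indicator indicator_vimage)
  qed
  have "emeasure lborel (T -` A) * emeasure lborel B
      = (\<integral>\<^sup>+ x. indicator A (T x) * emeasure lborel B \<partial>lborel)"
    using pre[of A] by (simp add: nn_integral_multc)
  also have "\<dots> = (\<integral>\<^sup>+ x. \<integral>\<^sup>+ y. indicator A (T x) * indicator B (y - T x) \<partial>lborel \<partial>lborel)"
    by (simp add: nn_integral_cmult shift B)
  also have "\<dots> = (\<integral>\<^sup>+ y. \<integral>\<^sup>+ x. indicator A (T x) * indicator B (y - T x) \<partial>lborel \<partial>lborel)"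
    by (rule lborel_pair.Fubini') measurable
  also have "\<dots> = (\<integral>\<^sup>+ y. \<integral>\<^sup>+ x. indicator A (y - T x) * indicator B (T x) \<partial>lborel \<partial>lborel)"
  proof (rule nn_integral_cong)
    fix y :: 'a
    obtain c where c: "y = T c" using T by (metis orthogonal_transformation_surj surjD)
    have "(\<integral>\<^sup>+ x. indicator A (T x) * indicator B (y - T x) \<partial>lborel)
        = (\<integral>\<^sup>+ x. indicator A (T (c - x)) * indicator B (y - T (c - x)) \<partial>lborel)"
      by (rule reflect[symmetric]) measurable
    thus "(\<integral>\<^sup>+ x. indicator A (T x) * indicator B (y - T x) \<partial>lborel) = (\<integral>\<^sup>+ x. indicator A (y - T x) * indicator B (T x) \<partial>lborel)"
      by (simp add: c linear_diff[OF lin])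
  qed
  also have "\<dots> = (\<integral>\<^sup>+ x. \<integral>\<^sup>+ y. indicator A (y - T x) * indicator B (T x) \<partial>lborel \<partial>lborel)"
    by (rule lborel_pair.Fubini') measurable
  also have "\<dots> = (\<integral>\<^sup>+ x. emeasure lborel A * indicator B (T x) \<partial>lborel)"
    by (simp add: nn_integral_multc shift A)
  also have "\<dots> = emeasure lborel A * emeasure lborel (T -` B)"
    using pre[of B] by (simp add: nn_integral_cmult)
  finally have "emeasure lborel (T -` A) * emeasure lborel B = emeasure lborel A * emeasure lborel B"
    by (simp add: vB)
  moreover have "emeasure lborel B \<noteq> 0" "emeasure lborel B \<noteq> \<infinity>"
    using unit_ball_vol_pos[of "real DIM('a)"] by (auto simp: B_def emeasure_ball less_le)
  ultimately show ?thesis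
    by (metis ennreal_mult_cancel_left infinity_ennreal_def mult.commute)
qed

text \<open>\<open>measure_of\<close> yields the intended values only once the set function is known
  to be countably additive. It is, because on Borel subsets of the sphere the cone volume is the
  push-forward \<open>N\<close> of Lebesgue measure on the punctured ball under radial
  projection.\<close>

lemma emeasure_sphere_measure:
  fixes A :: "(real^'n::finite) set"
  assumes R: "R > 0" and A: "A \<in> sets borel" "A \<subseteq> sphere 0 R"
  shows "emeasure (sphere_measure R) A = ennreal (real CARD('n) / R)
    * emeasure lborel {x. x \<noteq> 0 \<and> norm x \<le> R \<and> (R / norm x) *\<^sub>R x \<in> A}"
proof -
  define U :: "(real^'n) set" where "U = {x. x \<noteq> 0 \<and> norm x \<le> R}"
  define N where "N = distr (restrict_space lborel U) borel (\<lambda>x. (R / norm x) *\<^sub>R x)"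
  define \<A> :: "(real^'n) set set" where "\<A> = sets (restrict_space lborel (sphere 0 R))"
  define \<mu> :: "(real^'n) set \<Rightarrow> ennreal" where
    "\<mu> = (\<lambda>A. ennreal (real CARD('n) / R) * emeasure lborel (cone_over A))"
  have U: "U \<in> sets borel" by (auto simp: U_def)
  have m: "(\<lambda>x. (R / norm x) *\<^sub>R x) \<in> restrict_space lborel U \<rightarrow>\<^sub>M borel"
    by (rule measurable_restrict_space1) measurable
  have N: "emeasure N C = emeasure lborel {x. x \<noteq> 0 \<and> norm x \<le> R \<and> (R / norm x) *\<^sub>R x \<in> C}"
    if C: "C \<in> sets borel" for C
  proof -
    have "emeasure N C = emeasure (restrict_space lborel U) ((\<lambda>x. (R / norm x) *\<^sub>R x) -` C \<inter> U)"
      unfolding N_def using C by (subst emeasure_distr[OF m]) (simp_all add: space_restrict_space)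
    also have "\<dots> = emeasure lborel ((\<lambda>x. (R / norm x) *\<^sub>R x) -` C \<inter> U)"
      using U by (intro emeasure_restrict_space) simp_all
    also have "(\<lambda>x. (R / norm x) *\<^sub>R x) -` C \<inter> U
        = {x. x \<noteq> 0 \<and> norm x \<le> R \<and> (R / norm x) *\<^sub>R x \<in> C}"
      by (auto simp: U_def)
    finally show ?thesis .
  qed
  have \<A>: "\<A> = {C \<in> sets borel. C \<subseteq> sphere 0 R}"
    unfolding \<A>_def by (subst sets_restrict_space_iff[of "sphere 0 R" lborel for R, simplified] sets_restrict_space) auto
  have \<mu>: "\<mu> C = ennreal (real CARD('n) / R) * emeasure N C" if C: "C \<in> \<A>" for C
  proof -
    have CR: "C \<in> sets borel" "\<And>x. x \<in> C \<Longrightarrow> norm x = R" using C by (auto simp: \<A>)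
    define P where "P = {x. x \<noteq> 0 \<and> norm x \<le> R \<and> (R / norm x) *\<^sub>R x \<in> C}"
    \<comment> \<open>Removing the apex turns the cone into a preimage under radial projection,
      hence a Borel set; the apex itself is a null set.\<close>
    have P: "P = cone_over C - {0}"
    proof (intro equalityI subsetI)
      fix x assume x: "x \<in> P"
      hence "x = (norm x / R) *\<^sub>R ((R / norm x) *\<^sub>R x)" "norm x / R \<in> {0..1}"
        using R by (auto simp: P_def)
      thus "x \<in> cone_over C - {0}" using x unfolding cone_over_def P_def by blast
    next
      fix x assume "x \<in> cone_over C - {0}"
      then obtain t a where ta: "x = t *\<^sub>R a" "t \<in> {0..1}" "a \<in> C" "x \<noteq> 0" by (auto simp: cone_over_def)
      thus "x \<in> P" using R CR(2)[OF ta(3)] by (auto simp: P_def mult_left_le_one_le)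
    qed
    have "P \<in> sets borel" unfolding P_def using CR(1) by measurable
    moreover have "cone_over C = P \<union> (cone_over C \<inter> {0})" using P by auto
    moreover have "cone_over C \<inter> {0} \<in> null_sets lborel"
      by (rule countable_imp_null_set_lborel) auto
    ultimately have "emeasure lborel (cone_over C) = emeasure lborel P"
      by (metis emeasure_Un_null_set sets_lborel)
    thus ?thesis using N[OF CR(1)] by (simp add: \<mu>_def P_def)
  qed
  have sub: "\<A> \<subseteq> Pow (sphere 0 R)" by (auto simp: \<A>)
  have sig: "sigma_sets (sphere 0 R) \<A> = \<A>"
    using sets.sigma_sets_eq[of "restrict_space lborel (sphere (0::real^'n) R)"]
    by (simp add: \<A>_def space_restrict_space)
  have M: "sphere_measure R = measure_of (sphere 0 R) \<A> \<mu>"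
    unfolding sphere_measure_def \<A>_def \<mu>_def ..
  have setsM: "sets (sphere_measure R :: (real^'n) measure) = \<A>"
    unfolding M using sub by (simp add: sets_measure_of sig)
  have "emeasure (sphere_measure R) A = \<mu> A"
  proof (rule emeasure_measure_of[OF M sub])
    show "positive (sets (sphere_measure R)) \<mu>"
      by (simp add: positive_def \<mu>_def cone_over_def)
    show "A \<in> sets (sphere_measure R)" unfolding setsM using A by (simp add: \<A>)
    show "countably_additive (sets (sphere_measure R)) \<mu>"
      unfolding setsM
    proof (rule countably_additiveI)
      fix F :: "nat \<Rightarrow> _" assume F: "range F \<subseteq> \<A>" "disjoint_family F" "\<Union> (range F) \<in> \<A>"
      have "(\<Sum>i. \<mu> (F i)) = (\<Sum>i. ennreal (real CARD('n) / R) * emeasure N (F i))"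
        using F by (intro suminf_cong \<mu>) auto
      also have "\<dots> = ennreal (real CARD('n) / R) * (\<Sum>i. emeasure N (F i))" by simp
      also have "(\<Sum>i. emeasure N (F i)) = emeasure N (\<Union> (range F))"
        using F by (intro suminf_emeasure) (auto simp: N_def \<A>)
      finally show "(\<Sum>i. \<mu> (F i)) = \<mu> (\<Union> (range F))" using F by (simp add: \<mu>)
    qed
  qed
  thus ?thesis using A \<mu>[of A] N[of A] by (simp add: \<A>)
qed

lemma sets_sphere_measure:
  "sets (sphere_measure R :: (real^'n::finite) measure) = sets (restrict_space borel (sphere 0 R))"
proof -
  have "sigma_sets (sphere 0 R) (sets (restrict_space lborel (sphere (0::real^'n) R)))
      = sets (restrict_space lborel (sphere (0::real^'n) R))"
    using sets.sigma_sets_eq[of "restrict_space lborel (sphere (0::real^'n) R)"]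
    by (simp add: space_restrict_space)
  thus ?thesis
    unfolding sphere_measure_def
    by (subst sets_measure_of) (auto simp: sets_restrict_space)
qed

lemma space_sphere_measure:
  "space (sphere_measure R :: (real^'n::finite) measure) = sphere 0 R"
  unfolding sphere_measure_def by (rule space_measure_of) (auto simp: sets_restrict_space)

text \<open>\<open>lborel\<close> is the image of the product measure on the coordinates, so Fubini
  splits off one of them. The orthogonal hyperplane is not a type of its own; its share of the
  integral stays over \<open>Pi\<^sub>M (Basis - {b})\<close>.\<close>

lemma nn_integral_lborel_axial:
  fixes b :: "'a::euclidean_space" and F :: "real \<Rightarrow> real \<Rightarrow> ennreal"
  assumes b: "b \<in> Basis" and F: "case_prod F \<in> borel_measurable (borel \<Otimes>\<^sub>M borel)"
  shows "(\<integral>\<^sup>+x. F (x \<bullet> b) (norm x) \<partial>lborel)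
       = (\<integral>\<^sup>+t. \<integral>\<^sup>+f. F t (sqrt (t\<^sup>2 + (\<Sum>i\<in>Basis - {b}. (f i)\<^sup>2)))
            \<partial>Pi\<^sub>M (Basis - {b}) (\<lambda>_. lborel) \<partial>lborel)"
proof -
  interpret product_sigma_finite "\<lambda>_::'a. lborel :: real measure" by standard
  define A where "A = (Basis - {b} :: 'a set)"
  have A: "Basis = insert b A" "b \<notin> A" "finite A" using b by (auto simp: A_def)
  have mF: "(\<lambda>x. F (f x) (g x)) \<in> borel_measurable M"
    if "f \<in> borel_measurable M" "g \<in> borel_measurable M" for f g and M :: "'z measure"
    using measurable_compose[OF measurable_Pair[OF that] F] by simp
  have "(\<integral>\<^sup>+x. F (x \<bullet> b) (norm x) \<partial>(lborel :: 'a measure))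
     = (\<integral>\<^sup>+f. F ((\<Sum>i\<in>Basis. f i *\<^sub>R i) \<bullet> b) (norm (\<Sum>i\<in>Basis. f i *\<^sub>R i :: 'a)) \<partial>Pi\<^sub>M Basis (\<lambda>_. lborel))"
    unfolding lborel_eq[where 'a='a]
    by (subst nn_integral_distr) (auto intro!: mF)
  also have "\<dots> = (\<integral>\<^sup>+f. F (f b) (sqrt ((f b)\<^sup>2 + (\<Sum>i\<in>A. (f i)\<^sup>2))) \<partial>Pi\<^sub>M (insert b A) (\<lambda>_. lborel))"
  proof -
    have "norm (\<Sum>i\<in>Basis. f i *\<^sub>R i :: 'a) = sqrt ((f b)\<^sup>2 + (\<Sum>i\<in>A. (f i)\<^sup>2))" for f
    proof -
      have "norm (\<Sum>i\<in>Basis. f i *\<^sub>R i :: 'a) = sqrt (\<Sum>i\<in>Basis. (f i)\<^sup>2)"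
        by (simp add: euclidean_dist_l2[of _ 0, simplified] L2_set_def)
      thus ?thesis using sum.remove[OF finite_Basis b, of "\<lambda>i. (f i)\<^sup>2"] by (simp add: A_def)
    qed
    thus ?thesis unfolding A(1)[symmetric] using b by simp
  qed
  also have "\<dots> = (\<integral>\<^sup>+t. \<integral>\<^sup>+f. F ((f(b := t)) b) (sqrt (((f(b := t)) b)\<^sup>2 + (\<Sum>i\<in>A. ((f(b := t)) i)\<^sup>2))) \<partial>Pi\<^sub>M A (\<lambda>_. lborel) \<partial>lborel)"
    using A(3)
    by (intro product_nn_integral_insert_rev[OF A(3,2)] mF) auto
  also have "\<dots> = (\<integral>\<^sup>+t. \<integral>\<^sup>+f. F t (sqrt (t\<^sup>2 + (\<Sum>i\<in>A. (f i)\<^sup>2))) \<partial>Pi\<^sub>M A (\<lambda>_. lborel) \<partial>lborel)"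
  proof -
    have "(\<Sum>i\<in>A. ((f(b := t)) i)\<^sup>2) = (\<Sum>i\<in>A. (f i)\<^sup>2)" for f :: "'a \<Rightarrow> real" and t
      using A by (intro sum.cong) auto
    thus ?thesis by simp
  qed
  finally show ?thesis by (simp add: A_def)
qed

text \<open>Balls of radius a have volume V a^d, and this distribution function has derivative V d
  r^(d - 1). Half-lines generate the Borel sets, so agreement on them suffices. The result is polar
  integration in the hyperplane orthogonal to the axis.\<close>

lemma distr_norm_PiM_lborel:
  fixes A :: "'i set"
  assumes A: "finite A" "A \<noteq> {}"
  shows "distr (Pi\<^sub>M A (\<lambda>_. lborel)) borel (\<lambda>f. sqrt (\<Sum>i\<in>A. (f i)\<^sup>2))
    = density lborel (\<lambda>r. ennreal (unit_ball_vol (card A) * card A * r ^ (card A - 1)) * indicator {0..} r)"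
    (is "?M = ?N")
proof -
  define V where "V = unit_ball_vol (card A)"
  define d where "d = card A"
  have d: "d > 0" using A by (simp add: d_def card_gt_0_iff)
  have V: "V > 0" unfolding V_def by (rule unit_ball_vol_pos) simp
  have eM: "emeasure ?M {..a} = emeasure (Pi\<^sub>M A (\<lambda>_. lborel))
      ({f. sqrt (\<Sum>i\<in>A. (f i)\<^sup>2) \<le> a} \<inter> space (Pi\<^sub>M A (\<lambda>_. lborel)))" for a
    using A by (subst emeasure_distr) (auto intro!: arg_cong2[where f=emeasure])
  have M: "emeasure ?M {..a} = ennreal (V * a ^ d)" if "a > 0" for a
    unfolding eM V_def d_def by (rule emeasure_cball_aux[OF A(1) that])
  have N: "emeasure ?N {..a} = ennreal (V * a ^ d)" if "a \<ge> 0" for a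
  proof -
    have "emeasure ?N {..a} = (\<integral>\<^sup>+r. ennreal (V * d * r ^ (d - 1)) * indicator {0..a} r \<partial>lborel)"
      by (subst emeasure_density) (auto simp: V_def d_def indicator_def intro!: nn_integral_cong)
    also have "\<dots> = ennreal (V * a ^ d - V * 0 ^ d)"
      using that V d
      by (intro nn_integral_FTC_Icc) (auto intro!: derivative_eq_intros)
    finally show ?thesis using d by (simp add: zero_power)
  qed
  \<comment> \<open>The ball volume in \<open>M\<close> is for positive radii; radius 0 follows by
    letting r decrease to 0.\<close>
  have M0: "emeasure ?M {..0} = 0"
  proof -
    have "((\<lambda>r. ennreal (V * r ^ d)) \<longlongrightarrow> ennreal (V * 0 ^ d)) (at_right 0)"
      by (intro tendsto_intros)
    moreover have "eventually (\<lambda>r. emeasure ?M {..0} \<le> ennreal (V * r ^ d)) (at_right 0)"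
      unfolding eventually_at_right_field
    proof (intro exI[of _ 1] conjI allI impI)
      fix r :: real assume "0 < r" "r < 1"
      thus "emeasure ?M {..0} \<le> ennreal (V * r ^ d)"
        by (subst M[symmetric]) (auto intro!: emeasure_mono)
    qed simp
    ultimately have "emeasure ?M {..0} \<le> ennreal (V * 0 ^ d)"
      by (rule tendsto_lowerbound) simp
    thus ?thesis using d by (simp add: zero_power)
  qed
  show ?thesis
  proof (rule measure_eqI_generator_eq[where E = "range atMost" and \<Omega> = UNIV and A = "\<lambda>n. {..real n}"])
    show "Int_stable (range (atMost :: real \<Rightarrow> _))" by (auto simp: Int_stable_def)
    show "sets ?M = sigma_sets UNIV (range atMost)" "sets ?N = sigma_sets UNIV (range atMost)"
      by (simp_all add: borel_eq_atMost)
    show "(\<Union>i. {..real i}) = UNIV" using real_arch_simple by auto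
    show "emeasure ?M {..real i} \<noteq> \<infinity>" for i
      using M[of "real i"] M0 by (cases "i = 0") auto
    fix X :: "real set" assume "X \<in> range atMost"
    then obtain a where X: "X = {..a}" by auto
    show "emeasure ?M X = emeasure ?N X"
    proof (cases "a > 0")
      case True
      thus ?thesis by (simp only: X M[OF True] N[OF less_imp_le[OF True]])
    next
      case False
      have "emeasure ?M {..a} \<le> emeasure ?M {..0}" using False by (intro emeasure_mono) auto
      hence "emeasure ?M {..a} = 0" unfolding M0 by simp
      moreover have "emeasure ?N {..a} \<le> emeasure ?N {..0}" using False by (intro emeasure_mono) auto
      moreover have "emeasure ?N {..0} = 0" using N[of 0] d by (simp add: zero_power)
      ultimately have "emeasure ?N {..a} = 0" by (simp only: le_zero_eq)
      with \<open>emeasure ?M {..a} = 0\<close> show ?thesis by (simp only: X)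
    qed
  qed auto
qed

text \<open>In cylindrical coordinates (t, r) about the axis, t = r v makes the direction cosine v /
  sqrt (1 + v^2) independent of r, while the bound R on the norm becomes r <= R / sqrt (1 + v^2).
  The r-integral is then elementary.\<close>

lemma emeasure_lborel_sector:
  fixes b :: "'a::euclidean_space"
  assumes b: "b \<in> Basis" and dim: "DIM('a) = Suc d" "d > 0" and R: "R > 0" and B: "B \<in> sets borel"
  shows "emeasure lborel {x::'a. x \<noteq> 0 \<and> norm x \<le> R \<and> (x \<bullet> b) / norm x \<in> B}
    = ennreal (unit_ball_vol d * d * R ^ Suc d / Suc d)
      * (\<integral>\<^sup>+v. indicator B (v / sqrt (1 + v\<^sup>2)) * ennreal ((1 / sqrt (1 + v\<^sup>2)) ^ Suc d) \<partial>lborel)"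
proof -
  define F :: "real \<Rightarrow> real \<Rightarrow> ennreal" where
    "F = (\<lambda>t r. indicator B (t / r) * indicator {0<..R} r)"
  define c where "c = unit_ball_vol d * d"
  have c: "c \<ge> 0" unfolding c_def using unit_ball_vol_nonneg by simp
  note [measurable] = B
  have F: "case_prod F \<in> borel_measurable (borel \<Otimes>\<^sub>M borel)" unfolding F_def by measurable
  have card: "card (Basis - {b}) = d" "Basis - {b} \<noteq> {}" 
  proof -
    show "card (Basis - {b}) = d" using b dim by (simp add: card_Diff_singleton)
    thus "Basis - {b} \<noteq> {}" using dim(2) by (metis card.empty less_numeral_extra(3))
  qed
  define q where "q = (\<lambda>v::real. sqrt (1 + v\<^sup>2))"
  have q: "q v > 0" for v unfolding q_def by (simp add: add_pos_nonneg)
  have [measurable]: "q \<in> borel_measurable borel" unfolding q_def by measurable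
  have [measurable]: "Measurable.pred (borel \<Otimes>\<^sub>M borel) (\<lambda>x. snd x \<in> {0..R / q (fst x)})"
    unfolding atLeastAtMost_iff by measurable
  have "emeasure lborel {x::'a. x \<noteq> 0 \<and> norm x \<le> R \<and> (x \<bullet> b) / norm x \<in> B}
     = (\<integral>\<^sup>+x. F (x \<bullet> b) (norm x) \<partial>(lborel :: 'a measure))"
  proof -
    have "{x::'a. x \<noteq> 0 \<and> norm x \<le> R \<and> (x \<bullet> b) / norm x \<in> B} \<in> sets lborel" by measurable
    hence "emeasure lborel {x::'a. x \<noteq> 0 \<and> norm x \<le> R \<and> (x \<bullet> b) / norm x \<in> B}
      = (\<integral>\<^sup>+x. indicator {x::'a. x \<noteq> 0 \<and> norm x \<le> R \<and> (x \<bullet> b) / norm x \<in> B} x \<partial>lborel)" by simp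
    also have "\<dots> = (\<integral>\<^sup>+x. F (x \<bullet> b) (norm x) \<partial>(lborel :: 'a measure))"
      by (intro nn_integral_cong) (auto simp: F_def indicator_def)
    finally show ?thesis .
  qed
  also have "\<dots> = (\<integral>\<^sup>+t. \<integral>\<^sup>+f. F t (sqrt (t\<^sup>2 + (\<Sum>i\<in>Basis - {b}. (f i)\<^sup>2)))
            \<partial>Pi\<^sub>M (Basis - {b}) (\<lambda>_. lborel) \<partial>lborel)"
    by (rule nn_integral_lborel_axial[OF b F])
  also have "\<dots> = (\<integral>\<^sup>+t. \<integral>\<^sup>+r. ennreal (c * r ^ (d - 1)) * indicator {0..} r * F t (sqrt (t\<^sup>2 + r\<^sup>2)) \<partial>lborel \<partial>lborel)"
  proof (rule nn_integral_cong)
    fix t :: real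
    have "(\<integral>\<^sup>+f. F t (sqrt (t\<^sup>2 + (\<Sum>i\<in>Basis - {b}. (f i)\<^sup>2))) \<partial>Pi\<^sub>M (Basis - {b}) (\<lambda>_. lborel))
       = (\<integral>\<^sup>+r. F t (sqrt (t\<^sup>2 + r\<^sup>2)) \<partial>distr (Pi\<^sub>M (Basis - {b}) (\<lambda>_. lborel)) borel (\<lambda>f. sqrt (\<Sum>i\<in>Basis - {b}. (f i)\<^sup>2)))"
      unfolding F_def by (subst nn_integral_distr) (simp_all add: sum_nonneg)
    also have "\<dots> = (\<integral>\<^sup>+r. ennreal (c * r ^ (d - 1)) * indicator {0..} r * F t (sqrt (t\<^sup>2 + r\<^sup>2)) \<partial>lborel)"
      unfolding c_def F_def by (subst distr_norm_PiM_lborel[OF _ card(2)], simp, unfold card(1), subst nn_integral_density) simp_all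
    finally show "(\<integral>\<^sup>+f. F t (sqrt (t\<^sup>2 + (\<Sum>i\<in>Basis - {b}. (f i)\<^sup>2))) \<partial>Pi\<^sub>M (Basis - {b}) (\<lambda>_. lborel))
       = (\<integral>\<^sup>+r. ennreal (c * r ^ (d - 1)) * indicator {0..} r * F t (sqrt (t\<^sup>2 + r\<^sup>2)) \<partial>lborel)" .
  qed
  also have "\<dots> = (\<integral>\<^sup>+r. \<integral>\<^sup>+t. ennreal (c * r ^ (d - 1)) * indicator {0..} r * F t (sqrt (t\<^sup>2 + r\<^sup>2)) \<partial>lborel \<partial>lborel)"
    unfolding F_def by (rule lborel_pair.Fubini') measurable
  also have "\<dots> = (\<integral>\<^sup>+r. \<integral>\<^sup>+v. indicator B (v / q v) * (ennreal (c * r ^ d) * indicator {0..R / q v} r) \<partial>lborel \<partial>lborel)"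
  proof (intro nn_integral_cong_AE)
    \<comment> \<open>The scaling t = r v degenerates only at r = 0, a null set; for r < 0 both
      sides vanish by their indicators.\<close>
    have "AE r in lborel. r \<noteq> (0::real)" by (rule AE_lborel_singleton)
    thus "AE r in lborel. (\<integral>\<^sup>+t. ennreal (c * r ^ (d - 1)) * indicator {0..} r * F t (sqrt (t\<^sup>2 + r\<^sup>2)) \<partial>lborel)
       = (\<integral>\<^sup>+v. indicator B (v / q v) * (ennreal (c * r ^ d) * indicator {0..R / q v} r) \<partial>lborel)"
    proof eventually_elim
      case (elim r)
      show ?case
      proof (cases "r > 0")
        case True
        have eq: "sqrt ((r * v)\<^sup>2 + r\<^sup>2) = r * q v" for v
        proof -
          have "(r * v)\<^sup>2 + r\<^sup>2 = r\<^sup>2 * (1 + v\<^sup>2)" by algebra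
          thus ?thesis using True by (simp add: real_sqrt_mult q_def)
        qed
        have meas: "(\<lambda>t. ennreal (c * r ^ (d - 1)) * indicator {0..} r * F t (sqrt (t\<^sup>2 + r\<^sup>2))) \<in> borel_measurable borel"
          unfolding F_def by measurable
        \<comment> \<open>dt = r dv contributes the factor that raises the exponent d - 1 to d; here
          d > 0 matters.\<close>
        have pw: "r * r ^ (d - Suc 0) = r ^ d" using dim(2) by (cases d) auto
        have "(\<integral>\<^sup>+t. ennreal (c * r ^ (d - 1)) * indicator {0..} r * F t (sqrt (t\<^sup>2 + r\<^sup>2)) \<partial>lborel)
          = ennreal \<bar>r\<bar> * (\<integral>\<^sup>+v. ennreal (c * r ^ (d - 1)) * indicator {0..} r * F (0 + r * v) (sqrt ((0 + r * v)\<^sup>2 + r\<^sup>2)) \<partial>lborel)"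
          using True by (intro nn_integral_real_affine meas) simp
        also have "\<dots> = (\<integral>\<^sup>+v. ennreal r * (ennreal (c * r ^ (d - 1)) * F (r * v) (r * q v)) \<partial>lborel)"
          using True unfolding F_def by (subst nn_integral_cmult) (simp_all add: eq)
        also have "\<dots> = (\<integral>\<^sup>+v. indicator B (v / q v) * (ennreal (c * r ^ d) * indicator {0..R / q v} r) \<partial>lborel)"
        proof (rule nn_integral_cong)
          fix v
          have "ennreal r * ennreal (c * r ^ (d - 1)) = ennreal (c * r ^ d)"
            using True c by (simp add: mult.left_commute pw flip: ennreal_mult)
          hence 1: "ennreal r * (ennreal (c * r ^ (d - 1)) * x) = ennreal (c * r ^ d) * x" for x
            by (simp only: mult.assoc[symmetric])
          have 2: "F (r * v) (r * q v) = indicator B (v / q v) * indicator {0..R / q v} r"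
            using True q[of v] by (auto simp: F_def indicator_def field_simps)
          show "ennreal r * (ennreal (c * r ^ (d - 1)) * F (r * v) (r * q v))
            = indicator B (v / q v) * (ennreal (c * r ^ d) * indicator {0..R / q v} r)"
            unfolding 1 2 by (simp only: mult_ac)
        qed
        finally show ?thesis .
      qed (use elim in simp)
    qed
  qed
  also have "\<dots> = (\<integral>\<^sup>+v. \<integral>\<^sup>+r. indicator B (v / q v) * (ennreal (c * r ^ d) * indicator {0..R / q v} r) \<partial>lborel \<partial>lborel)"
    by (rule lborel_pair.Fubini') measurable
  also have "\<dots> = (\<integral>\<^sup>+v. ennreal (c * R ^ Suc d / Suc d) * (indicator B (v / q v) * ennreal ((1 / q v) ^ Suc d)) \<partial>lborel)"
  proof (rule nn_integral_cong)
    fix v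
    have "(\<integral>\<^sup>+r. indicator B (v / q v) * (ennreal (c * r ^ d) * indicator {0..R / q v} r) \<partial>lborel)
        = indicator B (v / q v) * (\<integral>\<^sup>+r. ennreal (c * r ^ d) * indicator {0..R / q v} r \<partial>lborel)"
      by (subst nn_integral_cmult) simp_all
    also have "(\<integral>\<^sup>+r. ennreal (c * r ^ d) * indicator {0..R / q v} r \<partial>lborel)
        = ennreal (c * (R / q v) ^ Suc d / Suc d - c * 0 ^ Suc d / Suc d)"
      using c R q[of v]
      by (intro nn_integral_FTC_Icc)
         (auto intro!: derivative_eq_intros simp del: power_Suc)
    also have "c * (R / q v) ^ Suc d / Suc d - c * 0 ^ Suc d / Suc d = (c * R ^ Suc d / Suc d) * (1 / q v) ^ Suc d"
      by (simp add: power_divide)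
    also have "ennreal \<dots> = ennreal (c * R ^ Suc d / Suc d) * ennreal ((1 / q v) ^ Suc d)"
      using c R q[of v] by (intro ennreal_mult) (simp_all add: less_imp_le)
    finally show "(\<integral>\<^sup>+r. indicator B (v / q v) * (ennreal (c * r ^ d) * indicator {0..R / q v} r) \<partial>lborel)
       = ennreal (c * R ^ Suc d / Suc d) * (indicator B (v / q v) * ennreal ((1 / q v) ^ Suc d))"
      by (simp only: mult_ac)
  qed
  also have "\<dots> = ennreal (c * R ^ Suc d / Suc d) * (\<integral>\<^sup>+v. indicator B (v / q v) * ennreal ((1 / q v) ^ Suc d) \<partial>lborel)"
    by (rule nn_integral_cmult) measurable
  finally show ?thesis unfolding c_def q_def .
qed

text \<open>The substitution w = v / sqrt (1 + v^2).\<close>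
lemma nn_integral_gnomonic:
  assumes p: "p > 0" and B: "B \<in> sets borel"
  shows "(\<integral>\<^sup>+v. indicator B (v / sqrt (1 + v\<^sup>2)) * ennreal ((1 / sqrt (1 + v\<^sup>2)) ^ (2 * p + 1)) \<partial>lborel)
    = (\<integral>\<^sup>+w. indicator B w * ennreal (indicator {-1<..<1} w * (1 - w\<^sup>2) ^ (p - 1)) \<partial>lborel)"
proof -
  define q where "q = (\<lambda>v::real. sqrt (1 + v\<^sup>2))"
  have sq: "1 + v\<^sup>2 > 0" for v :: real by (simp add: add_pos_nonneg)
  define \<phi> where "\<phi> = (\<lambda>v. v / q v)"
  have q0: "q v > 0" and q2: "(q v)\<^sup>2 = 1 + v\<^sup>2" for v
    unfolding q_def by (simp_all add: add_pos_nonneg)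
  have [measurable]: "q \<in> borel_measurable borel" "\<phi> \<in> borel_measurable borel" "B \<in> sets borel"
    using B unfolding \<phi>_def q_def by measurable
  have qd: "(q has_real_derivative v / q v) (at v)" for v
    unfolding q_def using sq[of v] by (auto intro!: derivative_eq_intros simp: field_simps)
  have d\<phi>: "(\<phi> has_real_derivative (1 / q v) ^ 3) (at v)" for v
  proof -
    have "(\<phi> has_real_derivative (1 * q v - v * (v / q v)) / (q v * q v)) (at v)"
      unfolding \<phi>_def using q0[of v] by (intro derivative_intros qd) auto
    also have "(1 * q v - v * (v / q v)) / (q v * q v) = ((q v)\<^sup>2 - v\<^sup>2) * (1 / q v) ^ 3"
      using q0[of v] by (simp add: field_simps power2_eq_square power3_eq_cube)
    also have "\<dots> = (1 / q v) ^ 3" by (simp add: q2)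
    finally show ?thesis .
  qed
  have one: "1 - (\<phi> v)\<^sup>2 = (1 / q v)\<^sup>2" for v
    using q0[of v] q2[of v] sq[of v] unfolding \<phi>_def by (simp add: power_divide divide_simps)
  have \<phi>1: "-1 < \<phi> v" "\<phi> v < 1" for v
  proof -
    have "(\<phi> v)\<^sup>2 < 1" using one[of v] zero_less_power[of "1 / q v" 2] q0[of v] by (metis diff_gt_0_iff_gt zero_less_divide_1_iff)
    thus "-1 < \<phi> v" "\<phi> v < 1" by (auto simp: abs_square_less_1 abs_less_iff)
  qed
  have mono: "\<phi> u \<le> \<phi> v" if "u \<le> v" for u v
    by (rule DERIV_nonneg_imp_nondecreasing[OF that]) (use d\<phi> q0 in \<open>auto intro!: exI[of _ "(1 / q _) ^ 3"] simp: less_imp_le\<close>)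
  have inv: "\<phi> (w / sqrt (1 - w\<^sup>2)) = w" if "-1 < w" "w < 1" for w
  proof -
    have pos: "1 - w\<^sup>2 > 0" using that by (simp add: abs_square_less_1)
    have "1 + (w / sqrt (1 - w\<^sup>2))\<^sup>2 = 1 / (1 - w\<^sup>2)"
      using pos by (simp add: power_divide field_simps)
    thus ?thesis using pos by (simp add: \<phi>_def q_def real_sqrt_divide)
  qed
  define f where "f = (\<lambda>w. indicator B w * ennreal ((1 - w\<^sup>2) ^ (p - 1)))"
  define h where "h = (\<lambda>v. indicator B (\<phi> v) * ennreal ((1 / q v) ^ (2 * p + 1)))"
  have [measurable]: "f \<in> borel_measurable borel" "h \<in> borel_measurable borel"
    unfolding f_def h_def by measurable
  \<comment> \<open>With phi' = q^(-3) and 1 - phi^2 = q^(-2), the exponents add up to 2 (p - 1) + 3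
    = 2 p + 1.\<close>
  have fh: "f (\<phi> v) * ennreal ((1 / q v) ^ 3) = h v" for v
  proof -
    have "((1 / q v)\<^sup>2) ^ (p - 1) * (1 / q v) ^ 3 = (1 / q v) ^ (2 * (p - 1) + 3)"
      by (simp only: power_mult power_add)
    also have "2 * (p - 1) + 3 = 2 * p + 1" using p by simp
    finally show ?thesis
      using q0[of v] by (simp add: f_def h_def one mult.assoc flip: ennreal_mult)
  qed
  \<comment> \<open>The substitution rule is for compact intervals, so the line is exhausted by
    symmetric ones; \<open>Suc n\<close> keeps them nondegenerate.\<close>
  have eq: "emeasure (density lborel f) {\<phi> (- real (Suc n))..\<phi> (real (Suc n))}
      = emeasure (density lborel h) {- real (Suc n)..real (Suc n)}" for n
  proof -
    have "(\<integral>\<^sup>+x. f x * indicator {\<phi> (- real (Suc n))..\<phi> (real (Suc n))} x \<partial>lborel)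
       = (\<integral>\<^sup>+x. f (\<phi> x) * ennreal ((1 / q x) ^ 3) * indicator {- real (Suc n)..real (Suc n)} x \<partial>lborel)"
    proof (rule nn_integral_substitution_aux)
      show "continuous_on {- real (Suc n)..real (Suc n)} (\<lambda>x. (1 / q x) ^ 3)"
        unfolding q_def by (intro continuous_intros) (auto simp: add_pos_nonneg less_imp_neq[symmetric])
    qed (use d\<phi> q0 in \<open>auto simp: less_imp_le\<close>)
    thus ?thesis by (subst (1 2) emeasure_density) (simp_all add: fh)
  qed
  have "emeasure (density lborel h) UNIV = emeasure (density lborel h) (\<Union>n. {- real (Suc n)..real (Suc n)})"
  proof -
    have "\<exists>n. - 1 - real n \<le> x \<and> x \<le> 1 + real n" for x
    proof -
      obtain n where "\<bar>x\<bar> \<le> real n" using real_arch_simple by blast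
      thus ?thesis by (intro exI[of _ n]) auto
    qed
    hence "(\<Union>n. {- real (Suc n)..real (Suc n)}) = UNIV" by auto
    thus ?thesis by simp
  qed
  also have "\<dots> = (SUP n. emeasure (density lborel h) {- real (Suc n)..real (Suc n)})"
    by (intro SUP_emeasure_incseq[symmetric]) (auto simp: incseq_def)
  also have "\<dots> = (SUP n. emeasure (density lborel f) {\<phi> (- real (Suc n))..\<phi> (real (Suc n))})"
    by (simp only: eq)
  also have "\<dots> = emeasure (density lborel f) (\<Union>n. {\<phi> (- real (Suc n))..\<phi> (real (Suc n))})"
  proof (intro SUP_emeasure_incseq)
    show "incseq (\<lambda>n. {\<phi> (- real (Suc n))..\<phi> (real (Suc n))})"
    proof (rule incseq_SucI)
      fix n
      have "\<phi> (- real (Suc (Suc n))) \<le> \<phi> (- real (Suc n))" "\<phi> (real (Suc n)) \<le> \<phi> (real (Suc (Suc n)))"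
        by (auto intro!: mono)
      thus "{\<phi> (- real (Suc n))..\<phi> (real (Suc n))} \<subseteq> {\<phi> (- real (Suc (Suc n)))..\<phi> (real (Suc (Suc n)))}"
        by (simp only: atLeastatMost_subset_iff) simp
    qed
  qed auto
  also have "(\<Union>n. {\<phi> (- real (Suc n))..\<phi> (real (Suc n))}) = {-1<..<1}"
  proof (intro equalityI subsetI)
    fix w :: real assume w: "w \<in> {-1<..<1}"
    define v where "v = w / sqrt (1 - w\<^sup>2)"
    obtain n where n: "\<bar>v\<bar> \<le> real n" using real_arch_simple by blast
    have "\<phi> (- real (Suc n)) \<le> \<phi> v" "\<phi> v \<le> \<phi> (real (Suc n))" using n by (auto intro!: mono)
    moreover have "\<phi> v = w" unfolding v_def using w by (intro inv) auto
    ultimately show "w \<in> (\<Union>n. {\<phi> (- real (Suc n))..\<phi> (real (Suc n))})" by auto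
  next
    fix w assume "w \<in> (\<Union>n. {\<phi> (- real (Suc n))..\<phi> (real (Suc n))})"
    then obtain n where "\<phi> (- real (Suc n)) \<le> w" "w \<le> \<phi> (real (Suc n))" by auto
    thus "w \<in> {-1<..<1}" using \<phi>1[of "- real (Suc n)"] \<phi>1[of "real (Suc n)"] by simp
  qed
  finally have "(\<integral>\<^sup>+v. h v \<partial>lborel) = (\<integral>\<^sup>+w. f w * indicator {-1<..<1} w \<partial>lborel)"
    by (simp add: emeasure_density)
  also have "\<dots> = (\<integral>\<^sup>+w. indicator B w * ennreal (indicator {-1<..<1} w * (1 - w\<^sup>2) ^ (p - 1)) \<partial>lborel)"
    by (intro nn_integral_cong) (auto simp: f_def indicator_def)
  finally show ?thesis unfolding h_def \<phi>_def q_def .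
qed

text \<open>Volume times dimension is the area of the unit sphere in dimension 2 p, the constant in
  the projected density.\<close>

lemma unit_ball_vol_even_mult:
  assumes "p > 0"
  shows "unit_ball_vol (real (2 * p)) * real (2 * p) = 2 * pi ^ p / fact (p - 1)"
  using assms unit_ball_vol_even[of p] fact_reduce[of p, where 'a=real] by simp

text \<open>Up to the apex and a rotation, the cone over the preimage of B is a sector of known
  volume. The factor (2 p + 1) / R of the surface measure cancels against R^(2 p + 1) / (2 p + 1)
  and leaves R^(2 p). For p = 1 the density is constant on (-1, 1): Archimedes' hat-box
  theorem.\<close>

lemma distr_sphere_measure_inner:
  fixes e :: "real^'n::finite"
  assumes e: "norm e = 1" and p: "p > 0" and n: "CARD('n) = 2 * p + 1" and R: "R > 0"
  shows "distr (sphere_measure R) borel (\<lambda>x. x \<bullet> e / R)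
    = density lborel (\<lambda>w. ennreal (2 * pi ^ p / fact (p - 1) * R ^ (2 * p) * (indicator {-1<..<1} w * (1 - w\<^sup>2) ^ (p - 1))))"
    (is "?M = ?N")
proof (rule measure_eqI)
  fix B assume "B \<in> sets ?M"
  hence B: "B \<in> sets borel" by simp
  note [measurable] = B
  define k :: 'n where "k = undefined"
  have b: "axis k (1::real) \<in> Basis" by (simp add: axis_in_Basis_iff)
  obtain T :: "real^'n \<Rightarrow> real^'n" where T: "orthogonal_transformation T" "T e = axis k 1"
    by (rule orthogonal_transformation_exists[of e "axis k 1"]) (simp_all add: e norm_axis_1)
  have lin: "linear T" using T(1) by (rule orthogonal_transformation_linear)
  have [measurable]: "(\<lambda>x. x \<bullet> e / R) \<in> sphere_measure R \<rightarrow>\<^sub>M borel"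
    unfolding measurable_cong_sets[OF sets_sphere_measure refl] by (rule measurable_restrict_space1) measurable
  define S where "S = {x. x \<bullet> e / R \<in> B} \<inter> sphere 0 R"
  define C :: "(real^'n) set" where "C = {x. x \<noteq> 0 \<and> norm x \<le> R \<and> x \<bullet> axis k 1 / norm x \<in> B}"
  have C: "C \<in> sets borel" unfolding C_def using B by measurable
  have S: "S \<in> sets borel"
  proof -
    have "{x. x \<bullet> e / R \<in> B} \<in> sets borel" by measurable
    thus ?thesis unfolding S_def by (intro sets.Int borel_closed[OF closed_sphere])
  qed
  have "emeasure ?M B = emeasure (sphere_measure R) S"
    using B by (subst emeasure_distr) (auto simp: S_def space_sphere_measure vimage_def)
  also have "\<dots> = ennreal (real CARD('n) / R) * emeasure lborel {x. x \<noteq> 0 \<and> norm x \<le> R \<and> (R / norm x) *\<^sub>R x \<in> S}"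
    by (rule emeasure_sphere_measure[OF R S]) (auto simp: S_def)
  also have "{x. x \<noteq> 0 \<and> norm x \<le> R \<and> (R / norm x) *\<^sub>R x \<in> S} = T -` C"
  proof -
    have "T x \<bullet> axis k 1 = x \<bullet> e" for x
      using T by (metis orthogonal_transformation_def)
    moreover have "norm (T x) = norm x" for x using T(1) by (rule orthogonal_transformation_norm)
    moreover have "T x = 0 \<longleftrightarrow> x = 0" for x
      using T(1) by (metis norm_eq_zero orthogonal_transformation_norm)
    ultimately show ?thesis using R by (auto simp: S_def C_def)
  qed
  also have "emeasure lborel (T -` C) = emeasure lborel C"
    by (rule emeasure_lborel_orthogonal_vimage[OF T(1) C])
  also have "\<dots> = ennreal (unit_ball_vol (2 * p) * (2 * p) * R ^ Suc (2 * p) / Suc (2 * p))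
      * (\<integral>\<^sup>+v. indicator B (v / sqrt (1 + v\<^sup>2)) * ennreal ((1 / sqrt (1 + v\<^sup>2)) ^ Suc (2 * p)) \<partial>lborel)"
    unfolding C_def using p n by (intro emeasure_lborel_sector b R B) simp_all
  also have "(\<integral>\<^sup>+v. indicator B (v / sqrt (1 + v\<^sup>2)) * ennreal ((1 / sqrt (1 + v\<^sup>2)) ^ Suc (2 * p)) \<partial>lborel)
      = (\<integral>\<^sup>+w. indicator B w * ennreal (indicator {-1<..<1} w * (1 - w\<^sup>2) ^ (p - 1)) \<partial>lborel)" (is "_ = ?J")
    using nn_integral_gnomonic[OF p B] by simp
  also have "ennreal (real CARD('n) / R) * (ennreal (unit_ball_vol (2 * p) * (2 * p) * R ^ Suc (2 * p) / Suc (2 * p)) * ?J)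
      = ennreal (2 * pi ^ p / fact (p - 1) * R ^ (2 * p)) * ?J"
  proof -
    have "ennreal (real CARD('n) / R) * ennreal (unit_ball_vol (2 * p) * (2 * p) * R ^ Suc (2 * p) / Suc (2 * p))
      = ennreal (real CARD('n) / R * (unit_ball_vol (2 * p) * (2 * p) * R ^ Suc (2 * p) / Suc (2 * p)))"
      using R by (intro ennreal_mult[symmetric]) (simp_all add: less_imp_le)
    also have "real CARD('n) / R * (unit_ball_vol (2 * p) * (2 * p) * R ^ Suc (2 * p) / Suc (2 * p))
      = unit_ball_vol (2 * p) * real (2 * p) * R ^ (2 * p)"
      unfolding n Suc_eq_plus1[symmetric] using R by (simp del: of_nat_Suc)
    finally show ?thesis using unit_ball_vol_even_mult[OF p] by (simp add: mult.assoc[symmetric])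
  qed
  also have "\<dots> = (\<integral>\<^sup>+w. ennreal (2 * pi ^ p / fact (p - 1) * R ^ (2 * p)) * (indicator B w * ennreal (indicator {-1<..<1} w * (1 - w\<^sup>2) ^ (p - 1))) \<partial>lborel)"
    by (intro nn_integral_cmult[symmetric]) measurable
  also have "\<dots> = (\<integral>\<^sup>+w. ennreal (2 * pi ^ p / fact (p - 1) * R ^ (2 * p) * (indicator {-1<..<1} w * (1 - w\<^sup>2) ^ (p - 1))) * indicator B w \<partial>lborel)"
  proof (intro nn_integral_cong)
    fix w :: real
    have "0 \<le> indicator {-1<..<1} w * (1 - w\<^sup>2) ^ (p - 1)"
      by (auto simp: indicator_def abs_square_less_1 abs_less_iff intro!: zero_le_power less_imp_le)
    thus "ennreal (2 * pi ^ p / fact (p - 1) * R ^ (2 * p)) * (indicator B w * ennreal (indicator {-1<..<1} w * (1 - w\<^sup>2) ^ (p - 1)))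
      = ennreal (2 * pi ^ p / fact (p - 1) * R ^ (2 * p) * (indicator {-1<..<1} w * (1 - w\<^sup>2) ^ (p - 1))) * indicator B w"
      using R by (subst ennreal_mult) (simp_all add: mult_ac)
  qed
  also have "\<dots> = emeasure ?N B"
    by (intro emeasure_density[symmetric]) measurable
  finally show "emeasure ?M B = emeasure ?N B" .
qed simp

lemma integral_sphere_measure_inner:
  fixes e :: "real^'n::finite" and f :: "real \<Rightarrow> real"
  assumes e: "norm e = 1" and p: "p > 0" and n: "CARD('n) = 2 * p + 1" and R: "R > 0"
    and f: "continuous_on {-1..1} f"
  shows "(\<integral>x. f (x \<bullet> e / R) \<partial>sphere_measure R)
    = 2 * pi ^ p / fact (p - 1) * R ^ (2 * p) * integral {-1..1} (\<lambda>w. f w * (1 - w\<^sup>2) ^ (p - 1))"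
proof -
  define K where "K = 2 * pi ^ p / fact (p - 1) * R ^ (2 * p)"
  \<comment> \<open>f is controlled on [-1, 1] only, so it is cut off to a Borel function; by
    Cauchy-Schwarz the sphere never sees the difference.\<close>
  define g where "g = (\<lambda>w. indicator {-1..1} w *\<^sub>R f w)"
  have K: "K \<ge> 0" using R by (simp add: K_def)
  have g: "g \<in> borel_measurable borel"
    unfolding g_def by (rule borel_measurable_continuous_on_indicator[OF _ f]) simp
  note [measurable] = g
  have [measurable]: "(\<lambda>x. x \<bullet> e / R) \<in> sphere_measure R \<rightarrow>\<^sub>M borel"
    unfolding measurable_cong_sets[OF sets_sphere_measure refl] by (rule measurable_restrict_space1) measurable
  have "(\<integral>x. f (x \<bullet> e / R) \<partial>sphere_measure R) = (\<integral>x. g (x \<bullet> e / R) \<partial>sphere_measure R)"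
  proof (rule Bochner_Integration.integral_cong[OF refl])
    fix x :: "real^'n" assume "x \<in> space (sphere_measure R)"
    hence "norm x = R" by (simp add: space_sphere_measure)
    hence "\<bar>x \<bullet> e\<bar> \<le> R" using Cauchy_Schwarz_ineq2[of x e] e by simp
    hence "x \<bullet> e / R \<in> {-1..1}" using R by (auto simp: field_simps abs_le_iff)
    thus "f (x \<bullet> e / R) = g (x \<bullet> e / R)" by (simp add: g_def)
  qed
  also have "\<dots> = (\<integral>w. g w \<partial>distr (sphere_measure R) borel (\<lambda>x. x \<bullet> e / R))"
    by (subst integral_distr) simp_all
  also have "\<dots> = (\<integral>w. (K * (indicator {-1<..<1} w * (1 - w\<^sup>2) ^ (p - 1))) *\<^sub>R g w \<partial>lborel)"
    unfolding distr_sphere_measure_inner[OF e p n R] K_def[symmetric]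
  proof (rule integral_density)
    show "AE w in lborel. 0 \<le> K * (indicator {-1<..<1} w * (1 - w\<^sup>2) ^ (p - 1))"
      by (intro AE_I2 mult_nonneg_nonneg[OF K])
         (auto simp: indicator_def abs_square_less_1 abs_less_iff intro!: zero_le_power less_imp_le)
  qed measurable
  also have "\<dots> = (\<integral>w. K * (indicator {-1..1} w *\<^sub>R (f w * (1 - w\<^sup>2) ^ (p - 1))) \<partial>lborel)"
  proof (rule integral_cong_AE)
    have "AE w in lborel. w \<noteq> (1::real)" "AE w in lborel. w \<noteq> (-1::real)" by (rule AE_lborel_singleton)+
    thus "AE w in lborel. (K * (indicator {-1<..<1} w * (1 - w\<^sup>2) ^ (p - 1))) *\<^sub>R g w
      = K * (indicator {-1..1} w *\<^sub>R (f w * (1 - w\<^sup>2) ^ (p - 1)))"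
      by eventually_elim (auto simp: g_def indicator_def)
    have "(\<lambda>w. indicator {-1..1} w *\<^sub>R (f w * (1 - w\<^sup>2) ^ (p - 1))) \<in> borel_measurable borel"
      by (rule borel_measurable_continuous_on_indicator) (auto intro!: continuous_intros f)
    thus "(\<lambda>w. K * (indicator {-1..1} w *\<^sub>R (f w * (1 - w\<^sup>2) ^ (p - 1)))) \<in> borel_measurable lborel"
      by simp
  qed measurable
  also have "\<dots> = K * (LINT w:{-1..1}|lborel. f w * (1 - w\<^sup>2) ^ (p - 1))"
    unfolding set_lebesgue_integral_def by (rule integral_mult_right_zero)
  also have "(LINT w:{-1..1}|lborel. f w * (1 - w\<^sup>2) ^ (p - 1)) = integral {-1..1} (\<lambda>w. f w * (1 - w\<^sup>2) ^ (p - 1))"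
    by (intro set_borel_integral_eq_integral borel_integrable_atLeastAtMost')
       (auto intro!: continuous_intros f)
  finally show ?thesis unfolding K_def .
qed

section \<open>The functions psi and tau\<close>

text \<open>\<open>deriv\<close> by itself says nothing about differentiability. The form e^(-r)
  times a polynomial in 1/r supplies it for every \<open>psi i\<close>, so that the defining
  recursion becomes a true derivative on r > 0.\<close>

lemma psi_eq_exp_poly: "\<exists>q. \<forall>r>0. psi i r = exp (- r) * poly q (1 / r)"
proof (induction i)
  case 0
  show ?case by (intro exI[of _ 1]) simp
next
  case (Suc i)
  then obtain q where q: "\<And>r. r > 0 \<Longrightarrow> psi i r = exp (- r) * poly q (1 / r)" by blast
  \<comment> \<open>With x = 1/r, the operator -(1/r) d/dr sends e^(-r) q(x) to e^(-r) (x q + x^3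
    q'); each \<open>pCons 0\<close> multiplies by x.\<close>
  have "psi (Suc i) r = exp (- r) * poly (pCons 0 (q + pCons 0 (pCons 0 (pderiv q)))) (1 / r)"
    if r: "r > 0" for r
  proof -
    have "((\<lambda>r. exp (- r) * poly q (1 / r)) has_real_derivative
        - exp (- r) * poly q (1 / r) + poly (pderiv q) (1 / r) * (- (1 / r\<^sup>2)) * exp (- r)) (at r)"
      using r by (auto intro!: derivative_eq_intros simp: power2_eq_square field_simps)
    hence "(psi i has_real_derivative
        - exp (- r) * poly q (1 / r) + poly (pderiv q) (1 / r) * (- (1 / r\<^sup>2)) * exp (- r)) (at r)"
      by (rule has_field_derivative_transform_within_open[where S = "{0<..}"]) (use r q in auto)
    hence "deriv (psi i) r = - exp (- r) * poly q (1 / r) + poly (pderiv q) (1 / r) * (- (1 / r\<^sup>2)) * exp (- r)"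
      by (rule DERIV_imp_deriv)
    thus ?thesis using r by (simp add: power2_eq_square field_simps)
  qed
  thus ?case by blast
qed

lemma psi_has_derivative:
  assumes r: "r > 0"
  shows "(psi i has_real_derivative - (r * psi (Suc i) r)) (at r)"
proof -
  obtain q where q: "\<And>r. r > 0 \<Longrightarrow> psi i r = exp (- r) * poly q (1 / r)"
    using psi_eq_exp_poly by blast
  have "(\<lambda>r. exp (- r) * poly q (1 / r)) field_differentiable (at r)"
    using r unfolding field_differentiable_def by (auto intro!: exI derivative_eq_intros)
  then obtain D where "((\<lambda>r. exp (- r) * poly q (1 / r)) has_real_derivative D) (at r)"
    unfolding field_differentiable_def by blast
  hence "(psi i has_real_derivative D) (at r)"
    by (rule has_field_derivative_transform_within_open[where S = "{0<..}"]) (use r q in auto)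
  moreover from this have "deriv (psi i) r = D" by (rule DERIV_imp_deriv)
  ultimately show ?thesis using r by simp
qed

lemma continuous_on_psi: "continuous_on {0<..} (psi i)"
  by (intro continuous_at_imp_continuous_on ballI DERIV_isCont[OF psi_has_derivative]) simp

lemma psi_1: "r > 0 \<Longrightarrow> psi (Suc 0) r = exp (- r) / r"
proof -
  assume "r > 0"
  have "psi 0 = (\<lambda>r. exp (- r))" by (rule ext) simp
  hence "(psi 0 has_real_derivative - exp (- r)) (at r)"
    by (auto intro!: derivative_eq_intros)
  thus ?thesis by (simp add: DERIV_imp_deriv)
qed

text \<open>Differentiating the identity at i and cancelling r gives the identity at i + 1. The case
  i = 0 amounts to f'' = f for f = e^(-r).\<close>

lemma psi_recurrence:
  assumes "r > 0"
  shows "r\<^sup>2 * psi (Suc (Suc i)) r = psi i r + (2 * real i + 1) * psi (Suc i) r"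
  using assms
proof (induction i arbitrary: r)
  case 0
  have "((\<lambda>r. exp (- r) / r) has_real_derivative - exp (- r) / r - exp (- r) / r\<^sup>2) (at r)"
    using 0 by (auto intro!: derivative_eq_intros simp: power2_eq_square field_simps)
  hence "(psi (Suc 0) has_real_derivative - exp (- r) / r - exp (- r) / r\<^sup>2) (at r)"
    by (rule has_field_derivative_transform_within_open[where S = "{0<..}"]) (use 0 psi_1 in auto)
  hence "psi (Suc (Suc 0)) r = - (- exp (- r) / r - exp (- r) / r\<^sup>2) / r"
    by (simp only: psi.simps DERIV_imp_deriv)
  thus ?case using 0 by (simp only: psi_1 psi.simps(1)) (simp add: power2_eq_square field_simps)
next
  case (Suc i)
  have "((\<lambda>r. r\<^sup>2 * psi (Suc (Suc i)) r) has_real_derivative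
      2 * r * psi (Suc (Suc i)) r + r\<^sup>2 * - (r * psi (Suc (Suc (Suc i))) r)) (at r)"
    using Suc.prems by (auto intro!: derivative_eq_intros psi_has_derivative simp del: psi.simps)
  moreover have "((\<lambda>r. r\<^sup>2 * psi (Suc (Suc i)) r) has_real_derivative
      - (r * psi (Suc i) r) + (2 * real i + 1) * - (r * psi (Suc (Suc i)) r)) (at r)"
  proof (rule has_field_derivative_transform_within_open[where S = "{0<..}"])
    show "((\<lambda>r. psi i r + (2 * real i + 1) * psi (Suc i) r) has_real_derivative
      - (r * psi (Suc i) r) + (2 * real i + 1) * - (r * psi (Suc (Suc i)) r)) (at r)"
      using Suc.prems by (intro DERIV_add DERIV_cmult psi_has_derivative)
  qed (use Suc in \<open>simp_all del: psi.simps\<close>)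
  ultimately have "2 * r * psi (Suc (Suc i)) r + r\<^sup>2 * - (r * psi (Suc (Suc (Suc i))) r)
      = - (r * psi (Suc i) r) + (2 * real i + 1) * - (r * psi (Suc (Suc i)) r)"
    by (rule DERIV_unique)
  hence "r * (r\<^sup>2 * psi (Suc (Suc (Suc i))) r) = r * (psi (Suc i) r + (2 * real (Suc i) + 1) * psi (Suc (Suc i)) r)"
    by (simp add: algebra_simps del: psi.simps)
  thus ?case using Suc.prems by (simp del: psi.simps)
qed

text \<open>cosh s is a power series in s^2, so -(1/s) d/ds acts on it as -2 d/dx at x = s^2.\<close>
definition tau_coeff :: "nat \<Rightarrow> nat \<Rightarrow> real" where
  "tau_coeff i = (diffs ^^ i) (\<lambda>n. 1 / fact (2 * n))"

text \<open>This is the i-th derivative of the entire function that equals cosh (sqrt x) for x >=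
  0.\<close>

definition tau_series :: "nat \<Rightarrow> real \<Rightarrow> real" where
  "tau_series i x = (\<Sum>n. tau_coeff i n * x ^ n)"

lemma summable_tau_coeff: "summable (\<lambda>n. tau_coeff i n * x ^ n)"
proof (induction i arbitrary: x)
  case 0
  show ?case
  proof (rule summable_comparison_test')
    show "summable (\<lambda>n. \<bar>x\<bar> ^ n /\<^sub>R fact n)" by (rule summable_exp_generic)
    show "norm (tau_coeff 0 n * x ^ n) \<le> \<bar>x\<bar> ^ n /\<^sub>R fact n" for n
    proof -
      have "fact n \<le> (fact (2 * n) :: real)" by (rule fact_mono) simp
      hence "1 / fact (2 * n) * \<bar>x\<bar> ^ n \<le> inverse (fact n) * \<bar>x\<bar> ^ n"
        by (intro mult_right_mono) (simp_all add: field_simps)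
      thus ?thesis by (simp add: tau_coeff_def abs_mult power_abs)
    qed
  qed
next
  case (Suc i)
  have "summable (\<lambda>n. diffs (tau_coeff i) n * x ^ n)"
    by (rule termdiff_converges_all) (rule Suc)
  thus ?case by (simp add: tau_coeff_def)
qed

lemma tau_series_has_derivative:
  "(tau_series i has_real_derivative tau_series (Suc i) x) (at x)"
proof -
  have "((\<lambda>x. \<Sum>n. tau_coeff i n * x ^ n) has_real_derivative (\<Sum>n. diffs (tau_coeff i) n * x ^ n)) (at x)"
    by (rule termdiffs_strong_converges_everywhere) (rule summable_tau_coeff)
  thus ?thesis by (simp add: tau_series_def[abs_def] tau_coeff_def)
qed

text \<open>The value of \<open>tau\<close> at 0 is a \<open>Lim\<close>, which is informative only
  if the limit exists. By the formula at i, the quotient agrees off 0 with a series in s^2 that is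
  continuous at 0, and this identifies the limit.\<close>

lemma tau_eq_tau_series: "tau i s = (- 2) ^ i * tau_series i (s\<^sup>2)"
proof (induction i arbitrary: s)
  case 0
  have "(\<lambda>n. if even n then s ^ n / fact n else 0) sums cosh s"
    using cosh_converges[of s] by (simp add: divide_inverse mult.commute cong: if_cong)
  hence "(\<lambda>n. (if even (2 * n) then s ^ (2 * n) / fact (2 * n) else 0)) sums cosh s"
    by (subst sums_mono_reindex[of "\<lambda>n. 2 * n"]) (auto simp: strict_mono_def elim!: evenE)
  hence "(\<lambda>n. tau_coeff 0 n * (s\<^sup>2) ^ n) sums cosh s"
    by (simp add: tau_coeff_def power_mult)
  thus ?case by (simp add: tau_series_def sums_iff)
next
  case (Suc i)
  have d: "deriv (tau i) t = - t * ((- 2) ^ Suc i * tau_series (Suc i) (t\<^sup>2))" for t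
  proof -
    have "((\<lambda>s. (- 2) ^ i * tau_series i (s\<^sup>2)) has_real_derivative
        (- 2) ^ i * (tau_series (Suc i) (t\<^sup>2) * (2 * t))) (at t)"
      by (intro DERIV_cmult DERIV_chain2[OF tau_series_has_derivative])
         (auto intro!: derivative_eq_intros)
    hence "(tau i has_real_derivative (- 2) ^ i * (tau_series (Suc i) (t\<^sup>2) * (2 * t))) (at t)"
      by (simp add: Suc[abs_def])
    thus ?thesis by (simp add: DERIV_imp_deriv)
  qed
  show ?case
  proof (cases "s = 0")
    case True
    have "((\<lambda>t. tau_series (Suc i) (t\<^sup>2)) \<longlongrightarrow> tau_series (Suc i) (0\<^sup>2)) (at 0)"
      by (rule isCont_tendsto_compose[OF DERIV_isCont[OF tau_series_has_derivative]])
         (intro tendsto_intros)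
    hence "((\<lambda>t. (- 2) ^ Suc i * tau_series (Suc i) (t\<^sup>2)) \<longlongrightarrow> (- 2) ^ Suc i * tau_series (Suc i) (0\<^sup>2)) (at 0)"
      by (rule tendsto_mult_left)
    hence "((\<lambda>t. - deriv (tau i) t / t) \<longlongrightarrow> (- 2) ^ Suc i * tau_series (Suc i) (0\<^sup>2)) (at 0)"
      by (rule Lim_transform_eventually) (auto simp: eventually_at_filter d)
    hence "Lim (at 0) (\<lambda>t. - deriv (tau i) t / t) = (- 2) ^ Suc i * tau_series (Suc i) (0\<^sup>2)"
      by (rule tendsto_Lim[OF trivial_limit_at])
    thus ?thesis unfolding True tau.simps by (simp only: if_False not_not simp_thms if_True)
  qed (simp add: d)
qed

lemma tau_has_derivative: "(tau i has_real_derivative - (s * tau (Suc i) s)) (at s)"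
proof -
  have "((\<lambda>s. (- 2) ^ i * tau_series i (s\<^sup>2)) has_real_derivative
      (- 2) ^ i * (tau_series (Suc i) (s\<^sup>2) * (2 * s))) (at s)"
    by (intro DERIV_cmult DERIV_chain2[OF tau_series_has_derivative])
       (auto intro!: derivative_eq_intros)
  thus ?thesis by (simp add: tau_eq_tau_series[abs_def] mult_ac)
qed

lemma tau_1: "s \<noteq> 0 \<Longrightarrow> tau (Suc 0) s = - sinh s / s"
proof -
  assume s: "s \<noteq> 0"
  have "tau 0 = cosh" by (rule ext) simp
  hence "(tau 0 has_real_derivative sinh s) (at s)"
    by (auto intro!: derivative_eq_intros)
  thus ?thesis using s by (simp add: DERIV_imp_deriv)
qed

text \<open>Same scheme as \<open>psi_recurrence\<close>: cosh also solves f'' = f, and the operator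
  is the same. Off 0 the factor s can be cancelled.\<close>

lemma tau_recurrence:
  assumes "s \<noteq> 0"
  shows "s\<^sup>2 * tau (Suc (Suc i)) s = tau i s + (2 * real i + 1) * tau (Suc i) s"
  using assms
proof (induction i arbitrary: s)
  case 0
  have "((\<lambda>s. - sinh s / s) has_real_derivative - cosh s / s + sinh s / s\<^sup>2) (at s)"
    using 0 by (auto intro!: derivative_eq_intros simp: power2_eq_square field_simps)
  hence "(tau (Suc 0) has_real_derivative - cosh s / s + sinh s / s\<^sup>2) (at s)"
    by (rule has_field_derivative_transform_within_open[where S = "- {0}"]) (use 0 tau_1 in auto)
  with tau_has_derivative have "- (s * tau (Suc (Suc 0)) s) = - cosh s / s + sinh s / s\<^sup>2"
    by (rule DERIV_unique)
  moreover have "s\<^sup>2 * tau (Suc (Suc 0)) s = - s * - (s * tau (Suc (Suc 0)) s)"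
    by (simp add: power2_eq_square del: tau.simps)
  ultimately have "s\<^sup>2 * tau (Suc (Suc 0)) s = - s * (- cosh s / s + sinh s / s\<^sup>2)"
    by (simp only:)
  also have "\<dots> = cosh s + (2 * real 0 + 1) * (- sinh s / s)"
    using 0 by (simp add: power2_eq_square field_simps)
  finally show ?case unfolding tau_1[OF 0] tau.simps(1) .
next
  case (Suc i)
  have "((\<lambda>s. s\<^sup>2 * tau (Suc (Suc i)) s) has_real_derivative
      2 * s * tau (Suc (Suc i)) s + s\<^sup>2 * - (s * tau (Suc (Suc (Suc i))) s)) (at s)"
    by (auto intro!: derivative_eq_intros tau_has_derivative simp del: tau.simps)
  moreover have "((\<lambda>s. s\<^sup>2 * tau (Suc (Suc i)) s) has_real_derivative
      - (s * tau (Suc i) s) + (2 * real i + 1) * - (s * tau (Suc (Suc i)) s)) (at s)"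
  proof (rule has_field_derivative_transform_within_open[where S = "- {0}"])
    show "((\<lambda>s. tau i s + (2 * real i + 1) * tau (Suc i) s) has_real_derivative
      - (s * tau (Suc i) s) + (2 * real i + 1) * - (s * tau (Suc (Suc i)) s)) (at s)"
      by (intro DERIV_add DERIV_cmult tau_has_derivative)
  qed (use Suc in \<open>auto simp del: tau.simps\<close>)
  ultimately have "2 * s * tau (Suc (Suc i)) s + s\<^sup>2 * - (s * tau (Suc (Suc (Suc i))) s)
      = - (s * tau (Suc i) s) + (2 * real i + 1) * - (s * tau (Suc (Suc i)) s)"
    by (rule DERIV_unique)
  hence "s * (s\<^sup>2 * tau (Suc (Suc (Suc i))) s) = s * (tau (Suc i) s + (2 * real (Suc i) + 1) * tau (Suc (Suc i)) s)"
    by (simp add: algebra_simps del: tau.simps)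
  thus ?case using Suc.prems by (simp del: tau.simps)
qed

section \<open>The sum over products of chi and tau\<close>

text \<open>Pascal's rule and an index shift. Each use lowers the binomial order by one, which
  brings sums of different length to a common range.\<close>

lemma sum_binomial_Suc:
  fixes f :: "nat \<Rightarrow> 'a::comm_semiring_1"
  shows "(\<Sum>i\<le>Suc n. of_nat (Suc n choose i) * f i) = (\<Sum>i\<le>n. of_nat (n choose i) * (f i + f (Suc i)))"
proof -
  have "(\<Sum>i\<le>Suc n. of_nat (Suc n choose i) * f i)
      = f 0 + (\<Sum>i\<le>n. of_nat (n choose Suc i) * f (Suc i)) + (\<Sum>i\<le>n. of_nat (n choose i) * f (Suc i))"
    by (simp add: sum.atMost_Suc_shift algebra_simps sum.distrib del: sum.atMost_Suc)
  also have "f 0 + (\<Sum>i\<le>n. of_nat (n choose Suc i) * f (Suc i)) = (\<Sum>i\<le>Suc n. of_nat (n choose i) * f i)"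
    by (simp add: sum.atMost_Suc_shift del: sum.atMost_Suc)
  also have "\<dots> = (\<Sum>i\<le>n. of_nat (n choose i) * f i)" by (simp add: binomial_eq_0)
  finally show ?thesis by (simp add: algebra_simps sum.distrib)
qed

text \<open>From (i + 1) C(n, i + 1) = (n - i) C(n, i) after an index shift. It makes the remainder
  in \<open>chi_tau_sum_recurrence\<close> vanish.\<close>

lemma sum_binomial_absorb:
  fixes f :: "nat \<Rightarrow> real"
  shows "(\<Sum>i\<le>n. real (n choose i) * (real i * f i)) = (\<Sum>i\<le>n. real (n choose i) * ((real n - real i) * f (Suc i)))"
proof (cases n)
  case (Suc m)
  have "(\<Sum>i\<le>n. real (n choose i) * (real i * f i)) = (\<Sum>i\<le>m. real (n choose Suc i) * (real (Suc i) * f (Suc i)))"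
    unfolding Suc by (subst sum.atMost_Suc_shift) simp
  also have "\<dots> = (\<Sum>i\<le>m. real (n choose i) * ((real n - real i) * f (Suc i)))"
  proof (rule sum.cong[OF refl])
    fix i assume i: "i \<in> {..m}"
    have "Suc i * (n choose Suc i) = (n - i) * (n choose i)"
      unfolding Suc using binomial_absorb_comp[of "Suc m" i] Suc_times_binomial[of i m]
      by (metis diff_Suc_1 binomial_absorption)
    hence "real (Suc i) * real (n choose Suc i) = (real n - real i) * real (n choose i)"
      using i Suc by (metis atMost_iff le_SucI of_nat_diff of_nat_mult)
    thus "real (n choose Suc i) * (real (Suc i) * f (Suc i)) = real (n choose i) * ((real n - real i) * f (Suc i))"
      by (metis mult.assoc mult.commute)
  qed
  also have "\<dots> = (\<Sum>i\<le>n. real (n choose i) * ((real n - real i) * f (Suc i)))"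
    unfolding Suc by simp
  finally show ?thesis .
qed simp

definition chi_tau_sum :: "real \<Rightarrow> nat \<Rightarrow> nat \<Rightarrow> real \<Rightarrow> real" where
  "chi_tau_sum R p j s = (\<Sum>i\<le>p - j. real ((p - j) choose i) * (chi (i + p) R * tau (i + j) s))"

text \<open>Two, one or no uses of Pascal's rule put all four sums over the binomials of order n = p
  - j - 2. The recurrence of \<open>chi\<close> consumes R^2, that of \<open>tau\<close> consumes
  s^2, and the remainder has binomial sum zero.\<close>

lemma chi_tau_sum_recurrence:
  assumes p: "j + 2 \<le> p" and s: "s \<noteq> 0"
  shows "chi_tau_sum R p j s + (2 * real j + 1) * chi_tau_sum R p (Suc j) s
    = (R\<^sup>2 + s\<^sup>2) * chi_tau_sum R p (Suc (Suc j)) s + 2 * s\<^sup>2 * chi_tau_sum R (Suc p) (Suc (Suc (Suc j))) s"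
proof -
  define n where "n = p - j - 2"
  have pn: "p = j + n + 2" using p by (simp add: n_def)
  define X where "X = (\<lambda>i. chi (i + p) R)"
  define Y where "Y = (\<lambda>i. tau (i + j) s)"
  have X: "R\<^sup>2 * X i = X (Suc (Suc i)) - (2 * real (i + p) + 1) * X (Suc i)" for i
    by (simp add: X_def)
  have Y: "s\<^sup>2 * Y (Suc (Suc i)) = Y i + (2 * real (i + j) + 1) * Y (Suc i)" for i
    using tau_recurrence[OF s, of "i + j"] by (simp add: Y_def del: tau.simps)
  let ?c = "\<lambda>i. real (n choose i)"
  have S0: "chi_tau_sum R p j s = (\<Sum>i\<le>n. ?c i * (X i * Y i + 2 * (X (Suc i) * Y (Suc i)) + X (Suc (Suc i)) * Y (Suc (Suc i))))"
  proof -
    have "p - j = Suc (Suc n)" using pn by simp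
    thus ?thesis unfolding chi_tau_sum_def
      by (simp only: sum_binomial_Suc X_def[symmetric] Y_def[symmetric]) (simp add: X_def Y_def algebra_simps)
  qed
  have S1: "chi_tau_sum R p (Suc j) s = (\<Sum>i\<le>n. ?c i * (X i * Y (Suc i) + X (Suc i) * Y (Suc (Suc i))))"
  proof -
    have "p - Suc j = Suc n" using pn by simp
    thus ?thesis unfolding chi_tau_sum_def
      by (simp only: sum_binomial_Suc) (simp add: X_def Y_def del: tau.simps)
  qed
  have S2: "chi_tau_sum R p (Suc (Suc j)) s = (\<Sum>i\<le>n. ?c i * (X i * Y (Suc (Suc i))))"
  proof -
    have "p - Suc (Suc j) = n" using pn by simp
    thus ?thesis unfolding chi_tau_sum_def X_def Y_def by (simp del: tau.simps)
  qed
  have S3: "chi_tau_sum R (Suc p) (Suc (Suc (Suc j))) s = (\<Sum>i\<le>n. ?c i * (X (Suc i) * Y (Suc (Suc (Suc i)))))"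
  proof -
    have "Suc p - Suc (Suc (Suc j)) = n" using pn by simp
    thus ?thesis unfolding chi_tau_sum_def X_def Y_def by (simp del: tau.simps)
  qed
  \<comment> \<open>In the remainder, X_(i+1) Y_(i+2) collects the coefficient 2 (i + j + 2 - p),
    that is -2 (n - i), and X_i Y_(i+1) collects 2 i.\<close>
  let ?Z = "\<lambda>i. X i * Y (Suc i)"
  have "(R\<^sup>2 + s\<^sup>2) * chi_tau_sum R p (Suc (Suc j)) s + 2 * s\<^sup>2 * chi_tau_sum R (Suc p) (Suc (Suc (Suc j))) s
     - (chi_tau_sum R p j s + (2 * real j + 1) * chi_tau_sum R p (Suc j) s)
     = (\<Sum>i\<le>n. ?c i * (2 * (real i * ?Z i) - 2 * ((real n - real i) * ?Z (Suc i))))"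
    unfolding S0 S1 S2 S3 sum_distrib_left sum.distrib[symmetric] sum_subtractf[symmetric]
  proof (rule sum.cong[OF refl])
    fix i
    have "(R\<^sup>2 + s\<^sup>2) * (X i * Y (Suc (Suc i))) + 2 * s\<^sup>2 * (X (Suc i) * Y (Suc (Suc (Suc i))))
       = (R\<^sup>2 * X i) * Y (Suc (Suc i)) + X i * (s\<^sup>2 * Y (Suc (Suc i))) + 2 * X (Suc i) * (s\<^sup>2 * Y (Suc (Suc (Suc i))))"
      by (simp add: algebra_simps)
    also have "\<dots> = (X i * Y i + 2 * (X (Suc i) * Y (Suc i)) + X (Suc (Suc i)) * Y (Suc (Suc i)))
        + (2 * real j + 1) * (X i * Y (Suc i) + X (Suc i) * Y (Suc (Suc i)))
        + (2 * (real i * ?Z i) - 2 * ((real n - real i) * ?Z (Suc i)))"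
      unfolding X Y pn by (simp add: algebra_simps)
    finally show "(R\<^sup>2 + s\<^sup>2) * (?c i * (X i * Y (Suc (Suc i)))) + 2 * s\<^sup>2 * (?c i * (X (Suc i) * Y (Suc (Suc (Suc i)))))
      - (?c i * (X i * Y i + 2 * (X (Suc i) * Y (Suc i)) + X (Suc (Suc i)) * Y (Suc (Suc i)))
         + (2 * real j + 1) * (?c i * (X i * Y (Suc i) + X (Suc i) * Y (Suc (Suc i)))))
      = ?c i * (2 * (real i * ?Z i) - 2 * ((real n - real i) * ?Z (Suc i)))"
      by algebra
  qed
  also have "\<dots> = 2 * (\<Sum>i\<le>n. ?c i * (real i * ?Z i)) - 2 * (\<Sum>i\<le>n. ?c i * ((real n - real i) * ?Z (Suc i)))"
    by (simp add: sum_distrib_left sum_subtractf[symmetric] right_diff_distrib mult_ac)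
  also have "\<dots> = 0" using sum_binomial_absorb[of n ?Z] by simp
  finally show ?thesis by simp
qed

text \<open>Differentiation raises each \<open>tau\<close> index by one, and Pascal's rule splits
  the result into two sums. The hypothesis makes p - j a successor, as that rule requires.\<close>

lemma chi_tau_sum_has_derivative:
  assumes "j < p"
  shows "(chi_tau_sum R p j has_real_derivative
    - (s * (chi_tau_sum R p (Suc j) s + chi_tau_sum R (Suc p) (Suc (Suc j)) s))) (at s)"
proof -
  define n where "n = p - Suc j"
  have n: "p - j = Suc n" "p - Suc j = n" "Suc p - Suc (Suc j) = n" using assms by (auto simp: n_def)
  have "chi_tau_sum R p (Suc j) s + chi_tau_sum R (Suc p) (Suc (Suc j)) s
     = (\<Sum>i\<le>p - j. real ((p - j) choose i) * (chi (i + p) R * tau (Suc (i + j)) s))"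
    unfolding n chi_tau_sum_def sum_binomial_Suc
    by (simp add: algebra_simps sum.distrib del: tau.simps chi.simps)
  hence eq: "- (s * (chi_tau_sum R p (Suc j) s + chi_tau_sum R (Suc p) (Suc (Suc j)) s))
     = (\<Sum>i\<le>p - j. real ((p - j) choose i) * (chi (i + p) R * - (s * tau (Suc (i + j)) s)))"
    by (simp add: sum_distrib_left mult_ac sum_negf del: tau.simps chi.simps)
  show ?thesis
    unfolding eq unfolding chi_tau_sum_def[abs_def] by (intro DERIV_sum DERIV_cmult tau_has_derivative)
qed

lemma isCont_chi_tau_sum: "isCont (chi_tau_sum R p j) s"
  unfolding chi_tau_sum_def[abs_def]
  by (intro continuous_intros DERIV_isCont[OF tau_has_derivative])

section \<open>The one-dimensional integral\<close>

definition chord :: "real \<Rightarrow> real \<Rightarrow> real \<Rightarrow> real" where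
  "chord R s w = sqrt (R\<^sup>2 + s\<^sup>2 - 2 * R * s * w)"

text \<open>The exponent m is p - 1.\<close>
definition zonal_integral :: "real \<Rightarrow> nat \<Rightarrow> nat \<Rightarrow> real \<Rightarrow> real" where
  "zonal_integral R m j s = integral {-1..1} (\<lambda>w. psi j (chord R s w) * (1 - w\<^sup>2) ^ m)"

text \<open>The radicand is at least (R - |s|)^2; thus the chord avoids the singularity of
  \<open>psi\<close> at 0.\<close>

lemma chord_radicand_pos:
  fixes R s w :: real
  assumes "\<bar>s\<bar> < R" "w \<in> {-1..1}"
  shows "0 < R\<^sup>2 + s\<^sup>2 - 2 * R * s * w"
proof -
  have "\<bar>s\<bar> * \<bar>w\<bar> \<le> \<bar>s\<bar> * 1" using assms(2) by (intro mult_left_mono) auto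
  hence "s * w \<le> \<bar>s\<bar>" using abs_ge_self[of "s * w"] by (simp add: abs_mult)
  hence "2 * R * (s * w) \<le> 2 * R * \<bar>s\<bar>" using assms by (intro mult_left_mono) auto
  moreover have "0 < (R - \<bar>s\<bar>)\<^sup>2" using assms by simp
  ultimately show ?thesis by (simp add: power2_diff mult.assoc)
qed

lemma chord_pos: "\<bar>s\<bar> < R \<Longrightarrow> w \<in> {-1..1} \<Longrightarrow> chord R s w > 0"
  using chord_radicand_pos[of s R w] by (simp add: chord_def)

lemma chord_power2: "\<bar>s\<bar> < R \<Longrightarrow> w \<in> {-1..1} \<Longrightarrow> (chord R s w)\<^sup>2 = R\<^sup>2 + s\<^sup>2 - 2 * R * s * w"
  using chord_radicand_pos[of s R w] by (simp add: chord_def)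

lemma chord_has_derivative:
  assumes "\<bar>s\<bar> < R" "w \<in> {-1..1}"
  shows "(chord R s has_real_derivative - (R * s) / chord R s w) (at w)"
    and "((\<lambda>s. chord R s w) has_real_derivative (s - R * w) / chord R s w) (at s)"
  unfolding chord_def[abs_def] using chord_radicand_pos[OF assms]
  by (auto intro!: derivative_eq_intros simp: field_simps)

text \<open>The denominator in the derivative of the chord cancels the factor r in the derivative of
  \<open>psi\<close>, so only factors polynomial in s and w remain.\<close>

lemma psi_chord_has_derivative:
  assumes "\<bar>s\<bar> < R" "w \<in> {-1..1}"
  shows "((\<lambda>w. psi j (chord R s w)) has_real_derivative R * s * psi (Suc j) (chord R s w)) (at w)"
    and "((\<lambda>s. psi j (chord R s w)) has_real_derivative - ((s - R * w) * psi (Suc j) (chord R s w))) (at s)"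
proof -
  have psi: "(psi j has_real_derivative - (chord R s w * psi (Suc j) (chord R s w))) (at (chord R s w))"
    by (rule psi_has_derivative[OF chord_pos[OF assms]])
  show "((\<lambda>w. psi j (chord R s w)) has_real_derivative R * s * psi (Suc j) (chord R s w)) (at w)"
    using DERIV_chain2[where f = "psi j" and g = "chord R s" and x = w, OF psi chord_has_derivative(1)[OF assms]]
      chord_pos[OF assms] by (simp add: mult_ac del: psi.simps)
  show "((\<lambda>s. psi j (chord R s w)) has_real_derivative - ((s - R * w) * psi (Suc j) (chord R s w))) (at s)"
    using DERIV_chain2[where f = "psi j" and g = "\<lambda>s. chord R s w" and x = s, OF psi chord_has_derivative(2)[OF assms]]
      chord_pos[OF assms] by (simp add: mult.commute del: psi.simps)
qed

lemma continuous_on_psi_chord: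
  "\<bar>s\<bar> < R \<Longrightarrow> continuous_on {-1..1} (\<lambda>w. psi j (chord R s w))"
  by (intro continuous_at_imp_continuous_on ballI DERIV_isCont[OF psi_chord_has_derivative(1)])

lemma psi_chord_integrable:
  assumes "\<bar>s\<bar> < R" "continuous_on {-1..1} g"
  shows "(\<lambda>w. psi j (chord R s w) * g w) integrable_on {-1..1}"
  by (intro integrable_continuous_interval continuous_intros continuous_on_psi_chord assms)

text \<open>There are no boundary terms, since (1 - w^2)^(m + 1) is zero at both ends. A factor w is
  thereby traded for a higher exponent and a higher index of \<open>psi\<close>.\<close>

lemma integral_psi_chord_by_parts:
  assumes s: "\<bar>s\<bar> < R"
  shows "2 * real (Suc m) * integral {-1..1} (\<lambda>w. psi j (chord R s w) * (w * (1 - w\<^sup>2) ^ m))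
    = R * s * zonal_integral R (Suc m) (Suc j) s"
proof -
  have "((\<lambda>w. R * s * (psi (Suc j) (chord R s w) * (1 - w\<^sup>2) ^ Suc m)
        - 2 * real (Suc m) * (psi j (chord R s w) * (w * (1 - w\<^sup>2) ^ m))) has_integral
      psi j (chord R s 1) * (1 - 1\<^sup>2) ^ Suc m - psi j (chord R s (-1)) * (1 - (-1)\<^sup>2) ^ Suc m) {-1..1}"
  proof (rule fundamental_theorem_of_calculus)
    fix w :: real assume w: "w \<in> {-1..1}"
    have "((\<lambda>w. psi j (chord R s w) * (1 - w\<^sup>2) ^ Suc m) has_real_derivative
       R * s * (psi (Suc j) (chord R s w) * (1 - w\<^sup>2) ^ Suc m)
        - 2 * real (Suc m) * (psi j (chord R s w) * (w * (1 - w\<^sup>2) ^ m))) (at w)"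
      by (rule derivative_eq_intros psi_chord_has_derivative(1)[OF s w] refl)+
         (simp add: algebra_simps del: psi.simps)
    thus "((\<lambda>w. psi j (chord R s w) * (1 - w\<^sup>2) ^ Suc m) has_vector_derivative
       R * s * (psi (Suc j) (chord R s w) * (1 - w\<^sup>2) ^ Suc m)
        - 2 * real (Suc m) * (psi j (chord R s w) * (w * (1 - w\<^sup>2) ^ m))) (at w within {-1..1})"
      by (simp add: has_real_derivative_iff_has_vector_derivative has_vector_derivative_at_within)
  qed simp
  hence "integral {-1..1} (\<lambda>w. R * s * (psi (Suc j) (chord R s w) * (1 - w\<^sup>2) ^ Suc m)
        - 2 * real (Suc m) * (psi j (chord R s w) * (w * (1 - w\<^sup>2) ^ m))) = 0"
    by (auto dest!: integral_unique)
  moreover have "(\<lambda>w. R * s * (psi (Suc j) (chord R s w) * (1 - w\<^sup>2) ^ Suc m)) integrable_on {-1..1}"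
    "(\<lambda>w. 2 * real (Suc m) * (psi j (chord R s w) * (w * (1 - w\<^sup>2) ^ m))) integrable_on {-1..1}"
    by (intro integrable_on_mult_right psi_chord_integrable s continuous_intros)+
  ultimately show ?thesis
    by (simp add: zonal_integral_def integral_diff del: psi.simps power_Suc of_nat_Suc)
qed

text \<open>The recurrence of \<open>psi\<close> is integrated with r^2 = R^2 + s^2 - 2 R s w. The
  term with w is removed by \<open>integral_psi_chord_by_parts\<close> at index j + 2, which
  produces index j + 3 at m + 1.\<close>

lemma zonal_integral_recurrence:
  assumes s: "\<bar>s\<bar> < R"
  shows "zonal_integral R m j s + (2 * real j + 1) * zonal_integral R m (Suc j) s
    = (R\<^sup>2 + s\<^sup>2) * zonal_integral R m (Suc (Suc j)) s - s\<^sup>2 * R\<^sup>2 / real (Suc m) * zonal_integral R (Suc m) (Suc (Suc (Suc j))) s"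
proof -
  note int = integrable_on_mult_right psi_chord_integrable s continuous_intros
  let ?P = "\<lambda>j g. integral {-1..1} (\<lambda>w. psi j (chord R s w) * g w)"
  let ?g = "\<lambda>w. (1 - w\<^sup>2) ^ m"
  have "zonal_integral R m j s + (2 * real j + 1) * zonal_integral R m (Suc j) s
    = integral {-1..1} (\<lambda>w. psi j (chord R s w) * ?g w + (2 * real j + 1) * (psi (Suc j) (chord R s w) * ?g w))"
    unfolding zonal_integral_def by (subst integral_add) (simp_all add: int del: psi.simps)
  also have "\<dots> = integral {-1..1} (\<lambda>w. (R\<^sup>2 + s\<^sup>2) * (psi (Suc (Suc j)) (chord R s w) * ?g w)
      - 2 * R * s * (psi (Suc (Suc j)) (chord R s w) * (w * ?g w)))"
  proof (rule integral_cong)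
    fix w :: real assume w: "w \<in> {-1..1}"
    have "psi j (chord R s w) * ?g w + (2 * real j + 1) * (psi (Suc j) (chord R s w) * ?g w)
      = (psi j (chord R s w) + (2 * real j + 1) * psi (Suc j) (chord R s w)) * ?g w"
      by (simp add: algebra_simps del: psi.simps)
    also have "\<dots> = (R\<^sup>2 + s\<^sup>2) * (psi (Suc (Suc j)) (chord R s w) * ?g w) - 2 * R * s * (psi (Suc (Suc j)) (chord R s w) * (w * ?g w))"
      unfolding psi_recurrence[OF chord_pos[OF s w], symmetric] chord_power2[OF s w]
      by (simp add: algebra_simps del: psi.simps)
    finally show "psi j (chord R s w) * ?g w + (2 * real j + 1) * (psi (Suc j) (chord R s w) * ?g w)
      = (R\<^sup>2 + s\<^sup>2) * (psi (Suc (Suc j)) (chord R s w) * ?g w) - 2 * R * s * (psi (Suc (Suc j)) (chord R s w) * (w * ?g w))" .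
  qed
  also have "\<dots> = (R\<^sup>2 + s\<^sup>2) * zonal_integral R m (Suc (Suc j)) s - 2 * R * s * ?P (Suc (Suc j)) (\<lambda>w. w * ?g w)"
    unfolding zonal_integral_def by (subst integral_diff) (simp_all add: int del: psi.simps)
  also have "?P (Suc (Suc j)) (\<lambda>w. w * ?g w) = R * s * zonal_integral R (Suc m) (Suc (Suc (Suc j))) s / (2 * real (Suc m))"
    using integral_psi_chord_by_parts[OF s, of m "Suc (Suc j)"] by (simp add: field_simps del: psi.simps of_nat_Suc)
  finally show ?thesis by (simp add: power2_eq_square del: of_nat_Suc)
qed

text \<open>Differentiation under the integral produces the factor R w - s, whose w part again goes
  by \<open>integral_psi_chord_by_parts\<close>. The point s = 0 is included, which later supplies
  continuity there.\<close>

lemma zonal_integral_has_derivative: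
  assumes s: "\<bar>s\<bar> < R"
  shows "(zonal_integral R m j has_real_derivative
    - (s * zonal_integral R m (Suc j) s) + R\<^sup>2 * s / (2 * real (Suc m)) * zonal_integral R (Suc m) (Suc (Suc j)) s) (at s)"
proof -
  note int = integrable_on_mult_right psi_chord_integrable s continuous_intros
  let ?g = "\<lambda>w. (1 - w\<^sup>2) ^ m"
  let ?D = "\<lambda>s w. - ((s - R * w) * psi (Suc j) (chord R s w)) * ?g w"
  have "((\<lambda>s. integral (cbox (-1) 1) (\<lambda>w. psi j (chord R s w) * ?g w)) has_field_derivative
      integral (cbox (-1) 1) (?D s)) (at s within {-R<..<R})"
  proof (rule leibniz_rule_field_derivative)
    fix x w :: real assume "x \<in> {-R<..<R}" "w \<in> cbox (-1) 1"
    hence "((\<lambda>s. psi j (chord R s w) * ?g w) has_real_derivative ?D x w) (at x)"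
      by (intro DERIV_cmult_right psi_chord_has_derivative(2)) auto
    thus "((\<lambda>s. psi j (chord R s w) * ?g w) has_field_derivative ?D x w) (at x within {-R<..<R})"
      by (rule has_field_derivative_at_within)
  next
    fix x assume "x \<in> {-R<..<R}"
    thus "(\<lambda>w. psi j (chord R x w) * ?g w) integrable_on cbox (-1) 1"
      unfolding cbox_interval by (intro psi_chord_integrable continuous_intros) auto
  next
    have "continuous_on ({-R<..<R} \<times> cbox (-1) 1) (\<lambda>z. psi (Suc j) (chord R (fst z) (snd z)))"
    proof (rule continuous_on_compose2[OF continuous_on_psi[of "Suc j"]])
      show "continuous_on ({-R<..<R} \<times> cbox (-1) 1) (\<lambda>z. chord R (fst z) (snd z))"
        unfolding chord_def by (intro continuous_intros)
      show "(\<lambda>z. chord R (fst z) (snd z)) ` ({-R<..<R} \<times> cbox (-1) 1) \<subseteq> {0<..}"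
        by (auto intro!: chord_pos)
    qed
    thus "continuous_on ({-R<..<R} \<times> cbox (-1) 1) (\<lambda>(s, w). ?D s w)"
      unfolding case_prod_unfold by (intro continuous_intros)
  qed (use s in auto)
  moreover have "at s within {-R<..<R} = at s" using s by (intro at_within_open) auto
  moreover have "integral {-1..1} (?D s) = - (s * zonal_integral R m (Suc j) s) + R\<^sup>2 * s / (2 * real (Suc m)) * zonal_integral R (Suc m) (Suc (Suc j)) s"
  proof -
    have "integral {-1..1} (?D s) = integral {-1..1} (\<lambda>w. R * (psi (Suc j) (chord R s w) * (w * ?g w)) - s * (psi (Suc j) (chord R s w) * ?g w))"
      by (rule integral_cong) (simp add: algebra_simps del: psi.simps)
    also have "\<dots> = R * integral {-1..1} (\<lambda>w. psi (Suc j) (chord R s w) * (w * ?g w)) - s * zonal_integral R m (Suc j) s"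
      unfolding zonal_integral_def by (subst integral_diff) (simp_all add: int del: psi.simps)
    also have "integral {-1..1} (\<lambda>w. psi (Suc j) (chord R s w) * (w * ?g w)) = R * s * zonal_integral R (Suc m) (Suc (Suc j)) s / (2 * real (Suc m))"
      using integral_psi_chord_by_parts[OF s, of m "Suc j"] by (simp add: field_simps del: psi.simps of_nat_Suc)
    finally show ?thesis by (simp add: power2_eq_square del: of_nat_Suc)
  qed
  ultimately show ?thesis by (simp add: zonal_integral_def[abs_def] cbox_interval)
qed

section \<open>Closed form of the zonal integral and three elementary cases\<close>

lemma chord_endpoints:
  assumes "\<bar>s\<bar> < R"
  shows "chord R s 1 = R - s" "chord R s (- 1) = R + s"
proof -
  have "R\<^sup>2 + s\<^sup>2 - 2 * R * s * 1 = (R - s)\<^sup>2" "R\<^sup>2 + s\<^sup>2 - 2 * R * s * (- 1) = (R + s)\<^sup>2"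
    by (simp_all add: power2_eq_square algebra_simps)
  thus "chord R s 1 = R - s" "chord R s (- 1) = R + s"
    unfolding chord_def using assms by simp_all
qed

lemma zonal_integral_eq_antiderivative:
  assumes "\<And>w. w \<in> {-1..1} \<Longrightarrow> (F has_real_derivative psi j (chord R s w) * (1 - w\<^sup>2) ^ m) (at w)"
  shows "zonal_integral R m j s = F 1 - F (- 1)"
proof -
  have "((\<lambda>w. psi j (chord R s w) * (1 - w\<^sup>2) ^ m) has_integral F 1 - F (-1)) {-1..1}"
    by (rule fundamental_theorem_of_calculus)
       (simp_all add: assms has_field_derivative_at_within flip: has_real_derivative_iff_has_vector_derivative)
  thus ?thesis unfolding zonal_integral_def by (rule integral_unique)
qed

text \<open>Times 2 pi^p R^(2 p) / (p - 1)!, the constant of the projected surface measure with p =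
  m + 1, this is the prefactor (-2 pi)^p 2 e^(-R). Its ratio for consecutive m is what matches the
  relations of \<open>zonal_integral\<close> with those of \<open>chi_tau_sum\<close>.\<close>

definition zonal_integral_const :: "real \<Rightarrow> nat \<Rightarrow> real" where
  "zonal_integral_const R m = (- 2) ^ Suc m * fact m / R ^ (2 * Suc m) * exp (- R)"

text \<open>s = 0 is left out because one relation is used after division by s and the other rests
  on \<open>tau_recurrence\<close>.\<close>

definition zonal_integral_closed :: "real \<Rightarrow> nat \<Rightarrow> nat \<Rightarrow> bool" where
  "zonal_integral_closed R m j \<longleftrightarrow> (\<forall>s. s \<noteq> 0 \<and> \<bar>s\<bar> < R \<longrightarrow> zonal_integral R m j s = zonal_integral_const R m * chi_tau_sum R (Suc m) j s)"

lemma exp_diff_cosh_sinh: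
  fixes R s :: real
  shows "exp (- (R - s)) = exp (- R) * (cosh s + sinh s)" "exp (- (R + s)) = exp (- R) * (cosh s - sinh s)"
  by (simp_all add: cosh_plus_sinh cosh_minus_sinh exp_diff exp_minus exp_add field_simps)

lemma tau_2: "s \<noteq> 0 \<Longrightarrow> tau (Suc (Suc 0)) s = (cosh s - sinh s / s) / s\<^sup>2"
  using tau_recurrence[of s 0] by (simp add: tau_1 field_simps del: tau.simps(2))

lemma zonal_integral_closed_0_0: "zonal_integral_closed R 0 0"
  unfolding zonal_integral_closed_def
proof (intro allI impI)
  fix s assume "s \<noteq> 0 \<and> \<bar>s\<bar> < R"
  hence s: "s \<noteq> 0" "\<bar>s\<bar> < R" "R > 0" by auto
  \<comment> \<open>With r = \<open>chord R s w\<close> one has dw = - r dr / (R s), and (1 + r)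
    e^(-r) is an antiderivative of - r e^(-r).\<close>
  let ?F = "\<lambda>w. (1 + chord R s w) * exp (- chord R s w) / (R * s)"
  have "zonal_integral R 0 0 s = ?F 1 - ?F (- 1)"
  proof (rule zonal_integral_eq_antiderivative)
    fix w :: real assume w: "w \<in> {-1..1}"
    show "(?F has_real_derivative psi 0 (chord R s w) * (1 - w\<^sup>2) ^ 0) (at w)"
      using chord_pos[OF s(2) w] s
      by (auto intro!: derivative_eq_intros chord_has_derivative(1)[OF s(2) w] simp: field_simps)
  qed
  also have "\<dots> = ((1 + (R - s)) * (exp (- R) * (cosh s + sinh s)) - (1 + (R + s)) * (exp (- R) * (cosh s - sinh s))) / (R * s)"
    unfolding chord_endpoints[OF s(2)] exp_diff_cosh_sinh by (simp add: diff_divide_distrib)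
  also have "\<dots> = zonal_integral_const R 0 * chi_tau_sum R (Suc 0) 0 s"
    unfolding zonal_integral_const_def chi_tau_sum_def using s
    by (simp add: tau_1 del: tau.simps(2)) (simp add: field_simps power2_eq_square)
  finally show "zonal_integral R 0 0 s = zonal_integral_const R 0 * chi_tau_sum R (Suc 0) 0 s" .
qed

lemma zonal_integral_closed_0_1: "zonal_integral_closed R 0 (Suc 0)"
  unfolding zonal_integral_closed_def
proof (intro allI impI)
  fix s assume "s \<noteq> 0 \<and> \<bar>s\<bar> < R"
  hence s: "s \<noteq> 0" "\<bar>s\<bar> < R" "R > 0" by auto
  \<comment> \<open>Here the factor r of dw cancels the denominator of
    \<open>psi (Suc 0)\<close>.\<close>
  let ?F = "\<lambda>w. exp (- chord R s w) / (R * s)"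
  have "zonal_integral R 0 (Suc 0) s = ?F 1 - ?F (- 1)"
  proof (rule zonal_integral_eq_antiderivative)
    fix w :: real assume w: "w \<in> {-1..1}"
    show "(?F has_real_derivative psi (Suc 0) (chord R s w) * (1 - w\<^sup>2) ^ 0) (at w)"
      using chord_pos[OF s(2) w] s unfolding psi_1[OF chord_pos[OF s(2) w]]
      by (auto intro!: derivative_eq_intros chord_has_derivative(1)[OF s(2) w] simp: field_simps)
  qed
  also have "\<dots> = (exp (- R) * (cosh s + sinh s) - exp (- R) * (cosh s - sinh s)) / (R * s)"
    unfolding chord_endpoints[OF s(2)] exp_diff_cosh_sinh by (simp add: diff_divide_distrib)
  also have "\<dots> = zonal_integral_const R 0 * chi_tau_sum R (Suc 0) (Suc 0) s"
    unfolding zonal_integral_const_def chi_tau_sum_def using s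
    by (simp add: tau_1 del: tau.simps(2)) (simp add: field_simps power2_eq_square)
  finally show "zonal_integral R 0 (Suc 0) s = zonal_integral_const R 0 * chi_tau_sum R (Suc 0) (Suc 0) s" .
qed

text \<open>The inductive route to index m at level m passes through index m - 2 at level m - 1,
  which does not exist for m = 1.\<close>

lemma zonal_integral_closed_1_1: "zonal_integral_closed R (Suc 0) (Suc 0)"
  unfolding zonal_integral_closed_def
proof (intro allI impI)
  fix s assume "s \<noteq> 0 \<and> \<bar>s\<bar> < R"
  hence s: "s \<noteq> 0" "\<bar>s\<bar> < R" "R > 0" by auto
  define k where "k = R * s"
  have k: "k \<noteq> 0" using s by (simp add: k_def)
  \<comment> \<open>Coefficients of a repeated integration by parts: in w, the successive
    antiderivatives of e^(-r) / r are e^(-r) / k, (1 + r) e^(-r) / k^2 and (r^2 + 3 r + 3) e^(-r) /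
    k^3, paired with 1 - w^2, 2 w and -2.\<close>
  define a b d where "a = 1 / k" and "b = 2 / k\<^sup>2" and "d = 2 / k ^ 3"
  let ?F = "\<lambda>w. exp (- chord R s w) * ((1 - w\<^sup>2) * a + w * (1 + chord R s w) * b
    - ((chord R s w)\<^sup>2 + 3 * chord R s w + 3) * d)"
  have "zonal_integral R (Suc 0) (Suc 0) s = ?F 1 - ?F (- 1)"
  proof (rule zonal_integral_eq_antiderivative)
    fix w :: real assume w: "w \<in> {-1..1}"
    define c c' where "c = chord R s w" and "c' = - k / c"
    have c: "c > 0" unfolding c_def by (rule chord_pos[OF s(2) w])
    have dc: "(chord R s has_real_derivative c') (at w)"
      using chord_has_derivative(1)[OF s(2) w] by (simp add: c'_def k_def c_def)
    have "(?F has_real_derivative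
       - c' * exp (- c) * ((1 - w\<^sup>2) * a + w * (1 + c) * b - (c\<^sup>2 + 3 * c + 3) * d)
       + exp (- c) * (- 2 * w * a + ((1 + c) + w * c') * b - (2 * c * c' + 3 * c') * d)) (at w)"
      unfolding c_def by (auto intro!: derivative_eq_intros dc simp: algebra_simps)
    also have "- c' * exp (- c) * ((1 - w\<^sup>2) * a + w * (1 + c) * b - (c\<^sup>2 + 3 * c + 3) * d)
       + exp (- c) * (- 2 * w * a + ((1 + c) + w * c') * b - (2 * c * c' + 3 * c') * d)
       = exp (- c) / c * (1 - w\<^sup>2) ^ Suc 0"
      using k c unfolding a_def b_def d_def c'_def by (simp add: field_simps power2_eq_square power3_eq_cube)
    finally show "(?F has_real_derivative psi (Suc 0) (chord R s w) * (1 - w\<^sup>2) ^ Suc 0) (at w)"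
      unfolding psi_1[OF chord_pos[OF s(2) w]] c_def .
  qed
  also have "\<dots> = exp (- R) * (cosh s + sinh s) * (2 * (1 + (R - s)) / (R * s)\<^sup>2 - 2 * ((R - s)\<^sup>2 + 3 * (R - s) + 3) / (R * s) ^ 3)
     - exp (- R) * (cosh s - sinh s) * (- 2 * (1 + (R + s)) / (R * s)\<^sup>2 - 2 * ((R + s)\<^sup>2 + 3 * (R + s) + 3) / (R * s) ^ 3)"
    unfolding chord_endpoints[OF s(2)] exp_diff_cosh_sinh a_def b_def d_def k_def by (simp add: mult.commute)
  \<comment> \<open>Sorted by \<open>tau\<close>: R^2 + R is \<open>chi 2 R\<close>, R^3 + 3 (R^2 +
    R) is \<open>chi 3 R\<close>, and the two factors in s are \<open>tau 1 s\<close> and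
    \<open>tau 2 s\<close>.\<close>
  also have "\<dots> = 4 / R ^ 4 * exp (- R) * ((R\<^sup>2 + R) * (- sinh s / s) + (R\<^sup>2 * R + 3 * (R\<^sup>2 + R)) * ((cosh s - sinh s / s) / s\<^sup>2))"
    using s by (simp add: field_simps power2_eq_square power3_eq_cube power4_eq_xxxx)
  also have "\<dots> = zonal_integral_const R (Suc 0) * chi_tau_sum R (Suc (Suc 0)) (Suc 0) s"
    unfolding zonal_integral_const_def chi_tau_sum_def using s
    by (simp add: tau_1 tau_2 eval_nat_numeral del: tau.simps(2))
  finally show "zonal_integral R (Suc 0) (Suc 0) s = zonal_integral_const R (Suc 0) * chi_tau_sum R (Suc (Suc 0)) (Suc 0) s" .
qed

section \<open>Propagation of the closed form over all m and j\<close>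

lemma zonal_integral_const_Suc: "R \<noteq> 0 \<Longrightarrow> R\<^sup>2 * zonal_integral_const R (Suc m) = - 2 * real (Suc m) * zonal_integral_const R m"
  by (simp add: zonal_integral_const_def field_simps power2_eq_square del: of_nat_Suc)

text \<open>Two expressions for the s-derivative at (m, j) are compared; the terms at (m, j + 1)
  cancel and s is divided out. Since the closed form is known only off 0, it is differentiated on
  the punctured interval.\<close>

lemma zonal_integral_closed_raise:
  assumes "zonal_integral_closed R m j" "zonal_integral_closed R m (Suc j)" "j \<le> m"
  shows "zonal_integral_closed R (Suc m) (Suc (Suc j))"
  unfolding zonal_integral_closed_def
proof (intro allI impI)
  fix s assume "s \<noteq> 0 \<and> \<bar>s\<bar> < R"
  hence s: "s \<noteq> 0" "\<bar>s\<bar> < R" "R \<noteq> 0" by auto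
  let ?S = "chi_tau_sum R"
  have "((\<lambda>s. zonal_integral_const R m * ?S (Suc m) j s) has_real_derivative
      zonal_integral_const R m * - (s * (?S (Suc m) (Suc j) s + ?S (Suc (Suc m)) (Suc (Suc j)) s))) (at s)"
    using assms(3) by (intro DERIV_cmult chi_tau_sum_has_derivative) simp
  hence "(zonal_integral R m j has_real_derivative
      zonal_integral_const R m * - (s * (?S (Suc m) (Suc j) s + ?S (Suc (Suc m)) (Suc (Suc j)) s))) (at s)"
    by (rule has_field_derivative_transform_within_open[where S = "{-R<..<R} - {0}"])
       (use assms(1) s in \<open>auto simp: zonal_integral_closed_def open_delete\<close>)
  hence "zonal_integral_const R m * - (s * (?S (Suc m) (Suc j) s + ?S (Suc (Suc m)) (Suc (Suc j)) s))
      = - (s * zonal_integral R m (Suc j) s) + R\<^sup>2 * s / (2 * real (Suc m)) * zonal_integral R (Suc m) (Suc (Suc j)) s"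
    by (rule DERIV_unique[OF _ zonal_integral_has_derivative[OF s(2)]])
  moreover have "zonal_integral R m (Suc j) s = zonal_integral_const R m * ?S (Suc m) (Suc j) s"
    using assms(2) s by (simp add: zonal_integral_closed_def)
  ultimately have "s * (R\<^sup>2 * zonal_integral R (Suc m) (Suc (Suc j)) s) = s * (- 2 * real (Suc m) * zonal_integral_const R m * ?S (Suc (Suc m)) (Suc (Suc j)) s)"
    by (simp add: field_simps del: of_nat_Suc)
  hence "R\<^sup>2 * zonal_integral R (Suc m) (Suc (Suc j)) s = R\<^sup>2 * (zonal_integral_const R (Suc m) * ?S (Suc (Suc m)) (Suc (Suc j)) s)"
    unfolding mult.assoc[symmetric] zonal_integral_const_Suc[OF s(3)] using s by (simp only: mult_cancel_left mult.assoc simp_thms)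
  thus "zonal_integral R (Suc m) (Suc (Suc j)) s = zonal_integral_const R (Suc m) * ?S (Suc (Suc m)) (Suc (Suc j)) s"
    using s by simp
qed

text \<open>By \<open>zonal_integral_const_Suc\<close> the coefficient -s^2 R^2 / (m + 1) becomes 2
  s^2, so the recurrences of the integral and of the sum coincide. \<open>j < m\<close> is the
  condition j + 2 <= p of the latter.\<close>

lemma zonal_integral_closed_lower:
  assumes "zonal_integral_closed R m (Suc j)" "zonal_integral_closed R m (Suc (Suc j))" "zonal_integral_closed R (Suc m) (Suc (Suc (Suc j)))" "j < m"
  shows "zonal_integral_closed R m j"
  unfolding zonal_integral_closed_def
proof (intro allI impI)
  fix s assume "s \<noteq> 0 \<and> \<bar>s\<bar> < R"
  hence s: "s \<noteq> 0" "\<bar>s\<bar> < R" "R \<noteq> 0" by auto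
  let ?S = "chi_tau_sum R"
  have zonal_integral: "zonal_integral R m (Suc j) s = zonal_integral_const R m * ?S (Suc m) (Suc j) s"
    "zonal_integral R m (Suc (Suc j)) s = zonal_integral_const R m * ?S (Suc m) (Suc (Suc j)) s"
    "zonal_integral R (Suc m) (Suc (Suc (Suc j))) s = zonal_integral_const R (Suc m) * ?S (Suc (Suc m)) (Suc (Suc (Suc j))) s"
    using assms s by (simp_all add: zonal_integral_closed_def)
  have "s\<^sup>2 * R\<^sup>2 / real (Suc m) * zonal_integral R (Suc m) (Suc (Suc (Suc j))) s
      = s\<^sup>2 / real (Suc m) * (R\<^sup>2 * zonal_integral_const R (Suc m)) * ?S (Suc (Suc m)) (Suc (Suc (Suc j))) s"
    by (simp add: zonal_integral)
  also have "\<dots> = - 2 * s\<^sup>2 * zonal_integral_const R m * ?S (Suc (Suc m)) (Suc (Suc (Suc j))) s"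
    unfolding zonal_integral_const_Suc[OF s(3)] by (simp del: of_nat_Suc)
  finally have "zonal_integral R m j s = zonal_integral_const R m * ((R\<^sup>2 + s\<^sup>2) * ?S (Suc m) (Suc (Suc j)) s
      + 2 * s\<^sup>2 * ?S (Suc (Suc m)) (Suc (Suc (Suc j))) s - (2 * real j + 1) * ?S (Suc m) (Suc j) s)"
    using zonal_integral_recurrence[OF s(2), of m j] by (simp add: zonal_integral algebra_simps)
  also have "\<dots> = zonal_integral_const R m * ?S (Suc m) j s"
    using chi_tau_sum_recurrence[of j "Suc m" s R] assms(4) s by simp
  finally show "zonal_integral R m j s = zonal_integral_const R m * ?S (Suc m) j s" .
qed

lemma zonal_integral_closed_diagonal: "zonal_integral_closed R m (Suc m) \<and> zonal_integral_closed R m m"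
proof (induction m)
  case 0
  show ?case using zonal_integral_closed_0_0 zonal_integral_closed_0_1 by simp
next
  case (Suc m)
  have 1: "zonal_integral_closed R (Suc m) (Suc (Suc m))" using Suc by (intro zonal_integral_closed_raise) auto
  moreover have "zonal_integral_closed R (Suc m) (Suc m)"
  proof (cases m)
    case 0
    thus ?thesis using zonal_integral_closed_1_1 by simp
  next
    case (Suc l)
    \<comment> \<open>Index l = m - 1 is outside the induction hypothesis. It comes down from the
      indices m and m + 1 at level m and from fact \<open>1\<close>, which belongs to the next
      level.\<close>
    have "zonal_integral_closed R m l" by (rule zonal_integral_closed_lower) (use Suc Suc.IH 1 in auto)
    thus ?thesis using Suc.IH Suc zonal_integral_closed_raise[of R m l] by simp
  qed
  ultimately show ?case by simp
qed

text \<open>The gap \<open>Suc m - j\<close> shrinks by 1, 2 and 2 in the premises of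
  \<open>zonal_integral_closed_lower\<close>; m is generalised since the third premise lives at m +
  1.\<close>

lemma zonal_integral_closed_all: "j \<le> Suc m \<Longrightarrow> zonal_integral_closed R m j"
proof (induction "Suc m - j" arbitrary: m j rule: less_induct)
  case less
  show ?case
  proof (cases "j < m")
    case True
    show ?thesis by (rule zonal_integral_closed_lower) (use less True in auto)
  next
    case False
    hence "j = m \<or> j = Suc m" using less.prems by auto
    thus ?thesis using zonal_integral_closed_diagonal by auto
  qed
qed

lemma zonal_integral_eq:
  assumes "j \<le> Suc m" "\<bar>s\<bar> < R"
  shows "zonal_integral R m j s = zonal_integral_const R m * chi_tau_sum R (Suc m) j s"
proof (cases "s = 0")
  case True
  let ?G = "\<lambda>s. zonal_integral_const R m * chi_tau_sum R (Suc m) j s"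
  have "zonal_integral R m j \<midarrow>0\<rightarrow> zonal_integral R m j 0"
    using DERIV_isCont[OF zonal_integral_has_derivative[of 0 R m j]] assms True by (simp add: isCont_def)
  moreover have "?G \<midarrow>0\<rightarrow> ?G 0"
    by (intro tendsto_mult_left isCont_chi_tau_sum[unfolded isCont_def])
  hence "zonal_integral R m j \<midarrow>0\<rightarrow> ?G 0"
  proof (rule Lim_transform_eventually)
    have "eventually (\<lambda>s. s \<in> {-R<..<R}) (at 0)"
      using assms True by (intro eventually_at_in_open') auto
    moreover have "eventually (\<lambda>s. s \<noteq> 0) (at (0::real))" by (simp add: eventually_at_filter)
    ultimately show "eventually (\<lambda>s. ?G s = zonal_integral R m j s) (at 0)"
      by eventually_elim (use zonal_integral_closed_all[OF assms(1), of R] in \<open>auto simp: zonal_integral_closed_def\<close>)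
  qed
  ultimately show ?thesis unfolding True by (rule LIM_unique)
qed (use zonal_integral_closed_all[OF assms(1), of R] assms in \<open>auto simp: zonal_integral_closed_def\<close>)

theorem theorem1p4:
  fixes p j :: nat and s :: "real^'n::finite" and R :: real
  assumes "p \<ge> 1" and "j \<le> p" and "CARD('n) = 2 * p + 1"
    and "norm s < R"
  shows "(\<integral>x. psi j (dist x s) \<partial>(sphere_measure R :: (real^'n) measure))
         = (- 2 * pi) ^ p * 2 * exp (- R)
           * (\<Sum>i = 0..p - j. real ((p - j) choose i) * chi (i + p) R * tau (i + j) (norm s))"
proof -
  have R: "R > 0" using assms(4) norm_ge_zero[of s] by linarith
  obtain m where m: "p = Suc m" using assms(1) by (cases p) auto
  \<comment> \<open>The direction of s; for s = 0 any unit vector serves.\<close>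
  obtain e :: "real^'n" where e: "norm e = 1" "s = norm s *\<^sub>R e"
  proof (cases "s = 0")
    case True
    thus ?thesis using that[of "axis undefined 1"] by (simp add: norm_axis_1)
  next
    case False
    thus ?thesis using that[of "s /\<^sub>R norm s"] by simp
  qed
  have "(\<integral>x. psi j (dist x s) \<partial>(sphere_measure R :: (real^'n) measure))
      = (\<integral>x. psi j (chord R (norm s) (x \<bullet> e / R)) \<partial>sphere_measure R)"
  proof (rule Bochner_Integration.integral_cong[OF refl])
    fix x :: "real^'n" assume "x \<in> space (sphere_measure R)"
    hence x: "norm x = R" by (simp add: space_sphere_measure)
    have "x \<bullet> s = norm s * (x \<bullet> e)" by (subst e(2)) simp
    moreover have "(dist x s)\<^sup>2 = (norm x)\<^sup>2 + (norm s)\<^sup>2 - 2 * (x \<bullet> s)"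
      by (simp add: dist_norm power2_norm_eq_inner inner_diff inner_commute)
    ultimately have "(dist x s)\<^sup>2 = R\<^sup>2 + (norm s)\<^sup>2 - 2 * R * norm s * (x \<bullet> e / R)"
      using R x by simp
    hence "dist x s = chord R (norm s) (x \<bullet> e / R)"
      unfolding chord_def by (metis real_sqrt_unique zero_le_dist)
    thus "psi j (dist x s) = psi j (chord R (norm s) (x \<bullet> e / R))" by simp
  qed
  also have "\<dots> = 2 * pi ^ p / fact (p - 1) * R ^ (2 * p)
      * integral {-1..1} (\<lambda>w. psi j (chord R (norm s) w) * (1 - w\<^sup>2) ^ (p - 1))"
    using assms by (intro integral_sphere_measure_inner e R continuous_on_psi_chord) auto
  also have "integral {-1..1} (\<lambda>w. psi j (chord R (norm s) w) * (1 - w\<^sup>2) ^ (p - 1)) = zonal_integral R m j (norm s)"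
    by (simp add: zonal_integral_def m)
  also have "\<dots> = zonal_integral_const R m * chi_tau_sum R p j (norm s)"
    using assms unfolding m by (intro zonal_integral_eq) auto
  also have "2 * pi ^ p / fact (p - 1) * R ^ (2 * p) * (zonal_integral_const R m * chi_tau_sum R p j (norm s))
      = (- 2 * pi) ^ p * 2 * exp (- R) * chi_tau_sum R p j (norm s)"
    using R unfolding zonal_integral_const_def m power_mult_distrib[of "- 2" pi] by (simp del: power_Suc mult_Suc_right)
  finally show ?thesis by (simp add: chi_tau_sum_def atMost_atLeast0 mult.assoc)
qed

end
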